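(* Let $W$ be a matrix weight of size $N$ on an interval $(a,b)$, with sequence of monic orthogonal polynomials $\{P_n\}_{n\in\mathbb N_0}$. If $W$ reduces, then the commutant $$\{T\in\mathrm{Mat}_N(\mathbb C): TP_n(x)=P_n(x)T\ \text{for all } n\in\mathbb N_0 \text{ and all } x\}$$ contains non-scalar matrices. If $a,b\in\mathbb R$ (i.e. the interval is finite), then the converse is also true: if this commutant contains a non-scalar matrix, then $W$ reduces.
   Context: A matrix weight of size $N$ on an interval $(a,b)\subseteq\mathbb R$ (possibly unbounded) is an integrable function $W:(a,b)\to\mathrm{Mat}_N(\mathbb C)$ such that $W(x)$ is positive semidefinite for all $x\in(a,b)$, positive definite for almost every $x$, and with finite moments $\int_a^b x^nW(x)\,dx$ of all orders $n\ge0$. The monic orthogonal polynomials $\{P_n\}_{n\ge0}$ of $W$ are the unique polynomials $P_n\in\mathrm{Mat}_N(\mathbb C)[x]$ of degree $n$ with leading coefficient $I$ such that $\int_a^bP_n(x)W(x)P_m(x)^*dx=0$ for $n\neq m$. Two matrix weights $W,W'$ of the same size on the same interval are equivalent if there is a nonsingular constant matrix $M$ with $W'(x)=MW(x)M^*$ for all $x$. $W$ reduces if it is equivalent to a direct sum (block diagonal weight) of matrix weights of smaller size. Weights are identified when they agree almost everywhere, so "for all $x$" in the definition of equivalence is understood as "for almost every $x$". A matrix is scalar if it is of the form $cI$, $c\in\mathbb C$. *)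

theory Defs
  imports "HOL-Analysis.Analysis" "Jordan_Normal_Form.Schur_Decomposition"
begin

text \<open>Matrices are those of \<open>Jordan_Normal_Form\<close>, since block sizes vary inside the notion of
  reducibility.  Intervals \<open>(a,b)\<close> have extended real endpoints; values of a weight
  outside its interval are irrelevant.\<close>

text \<open>The order on \<^typ>\<open>complex\<close> is that of \<open>Complex_Order\<close>: \<open>0 \<le> z\<close> means that
  \<open>z\<close> is real and nonnegative.  The product \<open>(A *\<^sub>v v) \<bullet>c v\<close> is \<open>v\<^sup>* A v\<close>.\<close>

definition pos_semidef :: "nat \<Rightarrow> complex mat \<Rightarrow> bool" where
  "pos_semidef N A \<longleftrightarrow> A \<in> carrier_mat N N \<and> mat_adjoint A = A \<and>
     (\<forall>v \<in> carrier_vec N. 0 \<le> (A *\<^sub>v v) \<bullet>c v)"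

definition pos_def :: "nat \<Rightarrow> complex mat \<Rightarrow> bool" where
  "pos_def N A \<longleftrightarrow> A \<in> carrier_mat N N \<and> mat_adjoint A = A \<and>
     (\<forall>v \<in> carrier_vec N. v \<noteq> 0\<^sub>v N \<longrightarrow> 0 < (A *\<^sub>v v) \<bullet>c v)"

definition mat_integrable :: "ereal \<Rightarrow> ereal \<Rightarrow> nat \<Rightarrow> (real \<Rightarrow> complex mat) \<Rightarrow> bool" where
  "mat_integrable a b N F \<longleftrightarrow>
     (\<forall>i<N. \<forall>j<N. set_integrable lebesgue (einterval a b) (\<lambda>x. F x $$ (i, j)))"

definition mat_integral :: "ereal \<Rightarrow> ereal \<Rightarrow> nat \<Rightarrow> (real \<Rightarrow> complex mat) \<Rightarrow> complex mat" where
  "mat_integral a b N F =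
     Matrix.mat N N (\<lambda>(i, j). set_lebesgue_integral lebesgue (einterval a b) (\<lambda>x. F x $$ (i, j)))"

text \<open>Integrability of the weight itself is the case \<open>n = 0\<close> of the moment condition.\<close>

definition matrix_weight :: "ereal \<Rightarrow> ereal \<Rightarrow> nat \<Rightarrow> (real \<Rightarrow> complex mat) \<Rightarrow> bool" where
  "matrix_weight a b N W \<longleftrightarrow> a < b \<and> 0 < N \<and>
     (\<forall>x \<in> einterval a b. pos_semidef N (W x)) \<and>
     (AE x in lebesgue. x \<in> einterval a b \<longrightarrow> pos_def N (W x)) \<and>
     (\<forall>n. mat_integrable a b N (\<lambda>x. complex_of_real x ^ n \<cdot>\<^sub>m W x))"

text \<open>\<open>Mat\<^sub>N(\<complex>)[x]\<close> is represented by matrices with polynomial entries.\<close>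

definition eval_mat :: "complex poly mat \<Rightarrow> real \<Rightarrow> complex mat" where
  "eval_mat P x = map_mat (\<lambda>p. poly p (complex_of_real x)) P"

definition coeff_mat :: "complex poly mat \<Rightarrow> nat \<Rightarrow> complex mat" where
  "coeff_mat P k = map_mat (\<lambda>p. coeff p k) P"

definition monic_mat_poly :: "nat \<Rightarrow> nat \<Rightarrow> complex poly mat \<Rightarrow> bool" where
  "monic_mat_poly N n P \<longleftrightarrow> P \<in> carrier_mat N N \<and>
     coeff_mat P n = 1\<^sub>m N \<and> (\<forall>k>n. coeff_mat P k = 0\<^sub>m N N)"

definition monic_orthogonal_polys ::
    "ereal \<Rightarrow> ereal \<Rightarrow> nat \<Rightarrow> (real \<Rightarrow> complex mat) \<Rightarrow> (nat \<Rightarrow> complex poly mat) \<Rightarrow> bool" where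
  "monic_orthogonal_polys a b N W P \<longleftrightarrow> (\<forall>n. monic_mat_poly N n (P n)) \<and>
     (\<forall>n m. n \<noteq> m \<longrightarrow>
        mat_integral a b N (\<lambda>x. eval_mat (P n) x * W x * mat_adjoint (eval_mat (P m) x)) = 0\<^sub>m N N)"

definition equivalent_weights ::
    "ereal \<Rightarrow> ereal \<Rightarrow> nat \<Rightarrow> (real \<Rightarrow> complex mat) \<Rightarrow> (real \<Rightarrow> complex mat) \<Rightarrow> bool" where
  "equivalent_weights a b N W W' \<longleftrightarrow> matrix_weight a b N W \<and> matrix_weight a b N W' \<and>
     (\<exists>M \<in> carrier_mat N N. invertible_mat M \<and>
        (AE x in lebesgue. x \<in> einterval a b \<longrightarrow> W' x = M * W x * mat_adjoint M))"

definition direct_sum :: "(real \<Rightarrow> complex mat) list \<Rightarrow> real \<Rightarrow> complex mat" where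
  "direct_sum Vs x = diag_block_mat (map (\<lambda>V. V x) Vs)"

text \<open>That the block sizes add up to \<open>N\<close> is part of \<^const>\<open>equivalent_weights\<close>, which
  requires the direct sum to be a weight of size \<open>N\<close>; as the blocks are smaller,
  there are at least two of them.\<close>

definition reduces :: "ereal \<Rightarrow> ereal \<Rightarrow> nat \<Rightarrow> (real \<Rightarrow> complex mat) \<Rightarrow> bool" where
  "reduces a b N W \<longleftrightarrow> (\<exists>Vs. (\<forall>V \<in> set Vs. \<exists>n<N. matrix_weight a b n V) \<and>
     equivalent_weights a b N W (direct_sum Vs))"

definition commutant :: "nat \<Rightarrow> (nat \<Rightarrow> complex poly mat) \<Rightarrow> complex mat set" where
  "commutant N P = {T \<in> carrier_mat N N. \<forall>n x. T * eval_mat (P n) x = eval_mat (P n) x * T}"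

definition scalar_matrix :: "nat \<Rightarrow> complex mat \<Rightarrow> bool" where
  "scalar_matrix N T \<longleftrightarrow> (\<exists>c. T = c \<cdot>\<^sub>m 1\<^sub>m N)"

end

theory Submission
  imports Defs "Jordan_Normal_Form.Jordan_Normal_Form_Existence"
begin

text \<open>Write \<open>S\<^sub>n = \<integral> x\<^sup>n W(x) dx\<close>.  Orthogonality of \<open>P\<^sub>n\<close> to the lower powers of \<open>x\<close> determines the
  coefficients of \<open>P\<^sub>n\<close> from the moments, so \<open>T S\<^sub>n = S\<^sub>n T\<^sup>*\<close> for all \<open>n\<close> forces \<open>T\<close> to commute
  with every \<open>P\<^sub>n\<close>; if \<open>M W M\<^sup>*\<close> is block diagonal and \<open>E\<close> is the projection onto a block,
  \<open>T = M\<inverse> E M\<close> satisfies \<open>T W = W T\<^sup>*\<close> and hence this condition.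

  Conversely, if \<open>T\<close> commutes with every \<open>P\<^sub>n\<close>, the relation \<open>\<integral> P\<^sub>n W = 0\<close> shows inductively that \<open>T\<close>
  commutes with \<open>S\<^sub>n S\<^sub>0\<inverse>\<close>.  These matrices are selfadjoint for the involution
  \<open>X \<mapsto> S\<^sub>0 X\<^sup>* S\<^sub>0\<inverse>\<close>, so a nonscalar \<open>T\<close> yields a nonscalar \<open>H\<close> with \<open>H S\<^sub>n = S\<^sub>n H\<^sup>*\<close> for all \<open>n\<close>.
  On a finite interval an integrable function is determined by its moments, so
  \<open>H W(x) = W(x) H\<^sup>*\<close> almost everywhere.  Then \<open>H\<close> is diagonalizable with real eigenvalues, and in an
  eigenbasis of \<open>H\<close> the entries of \<open>W(x)\<close> between different eigenvalues vanish.\<close>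

section \<open>Moments on a finite interval\<close>

text \<open>A countable Borel cover by sets of finite \<open>lborel\<close> measure also serves the
  completion. Sigma-finiteness is what lets \<open>density_zero\<close> conclude that a function
  with vanishing integrals over all measurable sets is null.\<close>

lemma sigma_finite_lebesgue: "sigma_finite_measure (lebesgue :: 'a::euclidean_space measure)"
proof
  obtain A :: "'a set set" where A: "countable A" "A \<subseteq> sets lborel" "\<Union>A = space lborel"
    "\<forall>a\<in>A. emeasure lborel a \<noteq> \<infinity>"
    using sigma_finite_measure.sigma_finite_countable[OF sigma_finite_lborel] by blast
  have "emeasure lebesgue a \<noteq> \<infinity>" if "a \<in> A" for a
  proof -
    have "a \<in> sets lborel" using A(2) that by blast
    then have "emeasure lebesgue a = emeasure lborel a" by simp
    then show ?thesis using A(4) that by simp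
  qed
  then show "\<exists>A :: 'a set set. countable A \<and> A \<subseteq> sets lebesgue \<and> \<Union>A = space lebesgue
      \<and> (\<forall>a\<in>A. emeasure lebesgue a \<noteq> \<infinity>)"
    using A by (intro exI[of _ A]) auto
qed

text \<open>A continuous \<open>g\<close> may be unbounded on the line, but it is bounded on the
  compact interval outside which \<open>h\<close> vanishes, so a constant multiple of
  \<open>h\<close> dominates the product.\<close>

lemma integrable_continuous_scaleR:
  fixes h :: "real \<Rightarrow> complex" and g :: "real \<Rightarrow> real"
  assumes h: "integrable lebesgue h" and supp: "\<And>x. x \<notin> {c..d} \<Longrightarrow> h x = 0"
    and g: "continuous_on UNIV g"
  shows "integrable lebesgue (\<lambda>x. g x *\<^sub>R h x)"
proof -
  have "bounded (g ` {c..d})"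
    by (intro compact_imp_bounded compact_continuous_image continuous_on_subset[OF g]) auto
  then obtain B where B: "\<And>x. x \<in> {c..d} \<Longrightarrow> norm (g x) \<le> B"
    unfolding bounded_iff by (metis imageI)
  have [measurable]: "h \<in> borel_measurable lebesgue"
    using h by auto
  have [measurable]: "g \<in> borel_measurable lebesgue"
    by (intro measurable_completion) (simp add: borel_measurable_continuous_onI[OF g])
  have "norm (g x *\<^sub>R h x) \<le> norm (\<bar>B\<bar> *\<^sub>R h x)" for x
  proof (cases "x \<in> {c..d}")
    case True
    from B[OF True] have "norm (g x) \<le> \<bar>B\<bar>" by simp
    then show ?thesis by (simp add: mult_right_mono)
  qed (simp add: supp)
  then show ?thesis
    by (intro Bochner_Integration.integrable_bound[OF integrable_scaleR_right[OF h, of "\<bar>B\<bar>"]]) auto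
qed

text \<open>By Weierstrass, \<open>g\<close> is uniformly close on \<open>{c..d}\<close> to
  polynomials, and these integrate to zero against \<open>h\<close>.\<close>

lemma integral_continuous_eq_0_of_moments:
  fixes h :: "real \<Rightarrow> complex" and g :: "real \<Rightarrow> real"
  assumes h: "integrable lebesgue h" and supp: "\<And>x. x \<notin> {c..d} \<Longrightarrow> h x = 0"
    and mom: "\<And>n. (\<integral>x. x ^ n *\<^sub>R h x \<partial>lebesgue) = 0"
    and g: "continuous_on UNIV g"
  shows "(\<integral>x. g x *\<^sub>R h x \<partial>lebesgue) = 0"
proof -
  let ?I = "\<integral>x. norm (h x) \<partial>lebesgue"
  have nonneg: "0 \<le> ?I" by simp
  have int: "integrable lebesgue (\<lambda>x. p x *\<^sub>R h x)" if "continuous_on UNIV p" for p :: "real \<Rightarrow> real"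
    using integrable_continuous_scaleR[OF h supp that] .
  have "norm (\<integral>x. g x *\<^sub>R h x \<partial>lebesgue) \<le> e * ?I" if "e > 0" for e
  proof -
    obtain p where p: "real_polynomial_function p"
      and close: "\<And>x. x \<in> {c..d} \<Longrightarrow> \<bar>g x - p x\<bar> < e"
      using Stone_Weierstrass_real_polynomial_function[OF compact_Icc, of c d g e]
        continuous_on_subset[OF g] \<open>e > 0\<close> by (metis subset_UNIV)
    from p obtain a n where p_eq: "p = (\<lambda>x. \<Sum>i\<le>n. a i * x ^ i)"
      unfolding real_polynomial_function_iff_sum by auto
    have p_cont: "continuous_on UNIV p"
      unfolding p_eq by (intro continuous_intros)
    have "(\<integral>x. p x *\<^sub>R h x \<partial>lebesgue) = (\<integral>x. (\<Sum>i\<le>n. a i *\<^sub>R (x ^ i *\<^sub>R h x)) \<partial>lebesgue)"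
      unfolding p_eq by (simp add: scaleR_sum_left)
    also have "\<dots> = (\<Sum>i\<le>n. \<integral>x. a i *\<^sub>R (x ^ i *\<^sub>R h x) \<partial>lebesgue)"
      by (intro Bochner_Integration.integral_sum integrable_scaleR_right int continuous_intros)
    also have "\<dots> = (\<Sum>i\<le>n. a i *\<^sub>R (\<integral>x. x ^ i *\<^sub>R h x \<partial>lebesgue))"
      by (simp del: scaleR_scaleR)
    also have "\<dots> = 0"
      by (simp add: mom)
    \<comment> \<open>The polynomial contributes nothing, so it can be subtracted and only the
      uniform error remains.\<close>
    finally have "(\<integral>x. g x *\<^sub>R h x \<partial>lebesgue) = (\<integral>x. g x *\<^sub>R h x \<partial>lebesgue) - (\<integral>x. p x *\<^sub>R h x \<partial>lebesgue)"
      by simp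
    also have "\<dots> = (\<integral>x. (g x - p x) *\<^sub>R h x \<partial>lebesgue)"
      by (simp add: scaleR_diff_left int g p_cont)
    also have "norm \<dots> \<le> (\<integral>x. e * norm (h x) \<partial>lebesgue)"
    proof (rule Bochner_Integration.integral_norm_bound_integral)
      show "integrable lebesgue (\<lambda>x. (g x - p x) *\<^sub>R h x)"
        by (intro int continuous_intros g p_cont)
      show "integrable lebesgue (\<lambda>x. e * norm (h x))"
        using h by auto
      show "norm ((g x - p x) *\<^sub>R h x) \<le> e * norm (h x)" for x
      proof (cases "x \<in> {c..d}")
        case True
        then show ?thesis using close[OF True] by (simp add: mult_right_mono)
      qed (simp add: supp)
    qed
    also have "\<dots> = e * ?I" by simp
    finally show ?thesis .
  qed
  then have "norm (\<integral>x. g x *\<^sub>R h x \<partial>lebesgue) \<le> 0 + e" if "e > 0" for e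
  proof -
    \<comment> \<open>Dividing by \<open>?I + 1\<close> instead of \<open>?I\<close> covers the case
      \<open>?I = 0\<close>.\<close>
    have "?I + 1 > 0" using nonneg by linarith
    then have "e / (?I + 1) > 0" using that by simp
    then have "norm (\<integral>x. g x *\<^sub>R h x \<partial>lebesgue) \<le> e / (?I + 1) * ?I"
      by fact
    also have "\<dots> \<le> e"
      using that \<open>?I + 1 > 0\<close> by (simp add: pos_divide_le_eq algebra_simps)
    finally show ?thesis by simp
  qed
  then have "norm (\<integral>x. g x *\<^sub>R h x \<partial>lebesgue) \<le> 0"
    by (rule field_le_epsilon)
  then show ?thesis by simp
qed

text \<open>The indicator of a nonempty closed set is a pointwise limit of continuous functions of
  the distance to the set, all bounded by 1, so dominated convergence applies with majorant
  \<open>norm (h x)\<close>.\<close>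

lemma integral_closed_eq_0_of_moments:
  fixes h :: "real \<Rightarrow> complex"
  assumes h: "integrable lebesgue h" and supp: "\<And>x. x \<notin> {c..d} \<Longrightarrow> h x = 0"
    and mom: "\<And>n. (\<integral>x. x ^ n *\<^sub>R h x \<partial>lebesgue) = 0"
    and K: "closed K"
  shows "(\<integral>x. indicator K x *\<^sub>R h x \<partial>lebesgue) = 0"
proof (cases "K = {}")
  case False
  \<comment> \<open>For positive \<open>n\<close>, \<open>g n\<close> is 1 on \<open>K\<close> and
    decreases linearly to 0 at distance \<open>1 / n\<close> from it.\<close>
  define g where "g n x = max 0 (1 - real n * infdist x K)" for n x
  have g_cont: "continuous_on UNIV (g n)" for n
    unfolding g_def by (intro continuous_intros)
  have "(\<lambda>n. \<integral>x. g n x *\<^sub>R h x \<partial>lebesgue) \<longlonglongrightarrow> (\<integral>x. indicator K x *\<^sub>R h x \<partial>lebesgue)"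
  proof (rule integral_dominated_convergence)
    show "(\<lambda>x. g n x *\<^sub>R h x) \<in> borel_measurable lebesgue" for n
      using integrable_continuous_scaleR[OF h supp g_cont] by auto
    have [measurable]: "K \<in> sets lebesgue" using K by auto
    have [measurable]: "h \<in> borel_measurable lebesgue" using h by auto
    show "(\<lambda>x. indicat_real K x *\<^sub>R h x) \<in> borel_measurable lebesgue"
      by measurable
    show "integrable lebesgue (\<lambda>x. norm (h x))" using h by auto
    have "(\<lambda>n. g n x) \<longlonglongrightarrow> indicator K x" for x
    proof (cases "x \<in> K")
      case True
      then show ?thesis by (simp add: g_def)
    next
      case False
      then have pos: "infdist x K > 0"
        using K \<open>K \<noteq> {}\<close> by (metis in_closed_iff_infdist_zero infdist_nonneg less_eq_real_def)
      obtain m where m: "1 < real m * infdist x K"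
        using reals_Archimedean3[OF pos] by blast
      have "g n x = 0" if "n \<ge> m" for n
      proof -
        have "real m * infdist x K \<le> real n * infdist x K"
          using that pos by (intro mult_right_mono) auto
        then show ?thesis using m by (simp add: g_def)
      qed
      then have "eventually (\<lambda>n. g n x = indicator K x) sequentially"
        using False by (auto simp: eventually_sequentially)
      then show ?thesis
        by (rule tendsto_eventually)
    qed
    then show "AE x in lebesgue. (\<lambda>n. g n x *\<^sub>R h x) \<longlonglongrightarrow> indicat_real K x *\<^sub>R h x"
      by (intro AE_I2 tendsto_scaleR tendsto_const)
    have "\<bar>g n x\<bar> \<le> 1" for n x
      unfolding g_def using infdist_nonneg[of x K] by auto
    then show "AE x in lebesgue. norm (g n x *\<^sub>R h x) \<le> norm (h x)" for n
      by (intro AE_I2) (simp add: mult_left_le_one_le)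
  qed
  moreover have "(\<integral>x. g n x *\<^sub>R h x \<partial>lebesgue) = 0" for n
    using integral_continuous_eq_0_of_moments[OF h supp mom g_cont] .
  ultimately show ?thesis
    by (simp add: LIMSEQ_const_iff)
qed simp

text \<open>It suffices that \<open>h\<close> integrates to zero over every measurable set
  \<open>S\<close>. Up to a null set, \<open>S\<close> is a countable union of compact sets, so its
  integral is a limit of integrals over closed sets.\<close>

lemma AE_eq_0_of_moments_compact_support:
  fixes h :: "real \<Rightarrow> complex"
  assumes h: "integrable lebesgue h" and supp: "\<And>x. x \<notin> {c..d} \<Longrightarrow> h x = 0"
    and mom: "\<And>n. (\<integral>x. x ^ n *\<^sub>R h x \<partial>lebesgue) = 0"
  shows "AE x in lebesgue. h x = 0"
proof (rule sigma_finite_measure.density_zero[OF sigma_finite_lebesgue h])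
  fix S :: "real set" assume S: "S \<in> sets lebesgue"
  have [measurable]: "h \<in> borel_measurable lebesgue" using h by auto
  obtain C T where C: "fsigma C" and T: "T \<in> null_sets lebesgue" and S_eq: "C \<union> T = S"
    using lebesgue_set_almost_fsigma[OF S] by metis
  obtain F :: "nat \<Rightarrow> real set" where F: "range F \<subseteq> Collect compact" and C_eq: "C = \<Union>(range F)"
    using fsigma_Union_compact C by metis
  \<comment> \<open>Partial unions make the sequence increasing, so that the indicators converge
    pointwise to that of \<open>C\<close>.\<close>
  define K where "K n = (\<Union>i\<le>n. F i)" for n
  have K_closed: "closed (K n)" for n
    unfolding K_def using F by (intro closed_UN) (auto intro: compact_imp_closed)
  have [measurable]: "K n \<in> sets lebesgue" for n using K_closed by auto
  have [measurable]: "C \<in> sets lebesgue"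
  proof -
    have "closed (F n)" for n using F by (auto intro: compact_imp_closed)
    then have "F n \<in> sets lebesgue" for n by auto
    then show ?thesis unfolding C_eq by auto
  qed
  have "(\<lambda>n. \<integral>x. indicator (K n) x *\<^sub>R h x \<partial>lebesgue) \<longlonglongrightarrow> (\<integral>x. indicator C x *\<^sub>R h x \<partial>lebesgue)"
  proof (rule integral_dominated_convergence)
    show "integrable lebesgue (\<lambda>x. norm (h x))" using h by auto
    have "(\<lambda>n. indicat_real (K n) x) \<longlonglongrightarrow> indicator C x" for x
    proof (cases "x \<in> C")
      case True
      then obtain m where "x \<in> F m" using C_eq by auto
      then have "x \<in> K n" if "n \<ge> m" for n using that by (auto simp: K_def)
      then have "eventually (\<lambda>n. indicat_real (K n) x = indicator C x) sequentially"
        using True by (intro eventually_sequentiallyI[of m]) simp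
      then show ?thesis by (rule tendsto_eventually)
    next
      case False
      then have "x \<notin> K n" for n by (auto simp: K_def C_eq)
      then show ?thesis using False by simp
    qed
    then show "AE x in lebesgue. (\<lambda>n. indicat_real (K n) x *\<^sub>R h x) \<longlonglongrightarrow> indicat_real C x *\<^sub>R h x"
      by (intro AE_I2 tendsto_scaleR tendsto_const)
    show "AE x in lebesgue. norm (indicat_real (K n) x *\<^sub>R h x) \<le> norm (h x)" for n
      by (auto simp: indicator_def)
  qed measurable
  moreover have "(\<integral>x. indicator (K n) x *\<^sub>R h x \<partial>lebesgue) = 0" for n
    using integral_closed_eq_0_of_moments[OF h supp mom K_closed] .
  ultimately have "(\<integral>x. indicator C x *\<^sub>R h x \<partial>lebesgue) = 0"
    by (simp add: LIMSEQ_const_iff)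
  moreover have "(\<integral>x. indicator S x *\<^sub>R h x \<partial>lebesgue) = (\<integral>x. indicator C x *\<^sub>R h x \<partial>lebesgue)"
  proof (rule integral_cong_AE)
    show "AE x in lebesgue. indicat_real S x *\<^sub>R h x = indicat_real C x *\<^sub>R h x"
      using AE_not_in[OF T] by eventually_elim (auto simp: indicator_def S_eq[symmetric])
  qed (use S in measurable)
  ultimately show "set_lebesgue_integral lebesgue S h = 0"
    by (simp add: set_lebesgue_integral_def)
qed

text \<open>Extending \<open>f\<close> by zero gives a function of compact support, because both
  endpoints are finite.\<close>

lemma AE_eq_0_of_moments:
  fixes f :: "real \<Rightarrow> complex"
  assumes f: "set_integrable lebesgue (einterval a b) f"
    and fin: "\<bar>a\<bar> \<noteq> \<infinity>" "\<bar>b\<bar> \<noteq> \<infinity>"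
    and mom: "\<And>n. set_lebesgue_integral lebesgue (einterval a b) (\<lambda>x. of_real x ^ n * f x) = 0"
  shows "AE x in lebesgue. x \<in> einterval a b \<longrightarrow> f x = 0"
proof -
  obtain c d where cd: "a = ereal c" "b = ereal d" using fin by auto
  define h where "h x = indicator (einterval a b) x *\<^sub>R f x" for x
  have "AE x in lebesgue. h x = 0"
  proof (rule AE_eq_0_of_moments_compact_support[where c = c and d = d])
    show "integrable lebesgue h" using f unfolding h_def set_integrable_def .
    show "h x = 0" if "x \<notin> {c..d}" for x using that by (auto simp: h_def cd)
    fix n
    have "x ^ n *\<^sub>R h x = indicator (einterval a b) x *\<^sub>R (of_real x ^ n * f x)" for x
      by (simp add: h_def scaleR_conv_of_real)
    then show "(\<integral>x. x ^ n *\<^sub>R h x \<partial>lebesgue) = 0"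
      using mom[of n] unfolding set_lebesgue_integral_def by simp
  qed
  then show ?thesis
    by eventually_elim (auto simp: h_def)
qed

section \<open>Matrix sums and moments of a weight\<close>

lemma dim_mat_adjoint [simp]:
  "dim_row (mat_adjoint A) = dim_col A" "dim_col (mat_adjoint A) = dim_row A"
  by (auto simp: mat_adjoint_def)

lemma mat_adjoint_carrier [simp]: "A \<in> carrier_mat n m \<Longrightarrow> mat_adjoint A \<in> carrier_mat m n"
  by (intro carrier_matI) auto

lemma index_mat_adjoint [simp]:
  "i < dim_col A \<Longrightarrow> j < dim_row A \<Longrightarrow> mat_adjoint A $$ (i, j) = conjugate (A $$ (j, i))"
  by (simp add: mat_adjoint_def mat_of_rows_def)

lemma index_mult_mat_sum:
  assumes "A \<in> carrier_mat n m" "B \<in> carrier_mat m k" "i < n" "j < k"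
  shows "(A * B) $$ (i, j) = (\<Sum>p<m. A $$ (i, p) * B $$ (p, j))"
  using assms by (auto simp: scalar_prod_def lessThan_atLeast0)

lemma mat_adjoint_adjoint [simp]: "mat_adjoint (mat_adjoint A) = (A :: complex mat)"
  by (rule eq_matI) auto

lemma mat_adjoint_mult:
  fixes A B :: "complex mat"
  assumes "A \<in> carrier_mat n m" "B \<in> carrier_mat m k"
  shows "mat_adjoint (A * B) = mat_adjoint B * mat_adjoint A"
proof (rule eq_matI)
  fix i j assume "i < dim_row (mat_adjoint B * mat_adjoint A)" "j < dim_col (mat_adjoint B * mat_adjoint A)"
  then have ij: "i < k" "j < n" using assms by auto
  have "mat_adjoint (A * B) $$ (i, j) = cnj ((A * B) $$ (j, i))"
    using assms ij by (simp add: conjugate_complex_def)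
  also have "\<dots> = (\<Sum>p<m. mat_adjoint B $$ (i, p) * mat_adjoint A $$ (p, j))"
    using assms ij
    by (simp add: index_mult_mat_sum[OF assms ij(2,1)] conjugate_complex_def mult.commute)
  also have "\<dots> = (mat_adjoint B * mat_adjoint A) $$ (i, j)"
    using index_mult_mat_sum[OF mat_adjoint_carrier[OF assms(2)] mat_adjoint_carrier[OF assms(1)] ij]
    by simp
  finally show "mat_adjoint (A * B) $$ (i, j) = (mat_adjoint B * mat_adjoint A) $$ (i, j)" .
qed (use assms in auto)

lemma mat_adjoint_add:
  fixes A B :: "complex mat"
  assumes "A \<in> carrier_mat n m" "B \<in> carrier_mat n m"
  shows "mat_adjoint (A + B) = mat_adjoint A + mat_adjoint B"
  using assms by (intro eq_matI) (auto simp: conjugate_complex_def)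

lemma mat_adjoint_smult: "mat_adjoint (c \<cdot>\<^sub>m A) = cnj c \<cdot>\<^sub>m mat_adjoint A"
  by (intro eq_matI) (auto simp: conjugate_complex_def)

lemma mat_adjoint_one [simp]: "mat_adjoint (1\<^sub>m n :: complex mat) = 1\<^sub>m n"
  by (rule eq_matI) (auto simp: conjugate_complex_def)

text \<open>The size \<open>N\<close> is an argument because the type of matrices does not fix
  dimensions: even the empty sum must be an \<open>N\<close> by \<open>N\<close> zero
  matrix.\<close>

definition msum :: "nat \<Rightarrow> nat \<Rightarrow> (nat \<Rightarrow> complex mat) \<Rightarrow> complex mat" where
  "msum N d f = Matrix.mat N N (\<lambda>(i, j). \<Sum>k<d. f k $$ (i, j))"

lemma msum_carrier [simp]: "msum N d f \<in> carrier_mat N N"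
  by (simp add: msum_def)

lemma dim_msum [simp]: "dim_row (msum N d f) = N" "dim_col (msum N d f) = N"
  by (simp_all add: msum_def)

lemma index_msum [simp]: "i < N \<Longrightarrow> j < N \<Longrightarrow> msum N d f $$ (i, j) = (\<Sum>k<d. f k $$ (i, j))"
  by (simp add: msum_def)

lemma msum_Suc: "f d \<in> carrier_mat N N \<Longrightarrow> msum N (Suc d) f = msum N d f + f d"
  by (rule eq_matI) auto

lemma msum_cong: "(\<And>k. k < d \<Longrightarrow> f k = g k) \<Longrightarrow> msum N d f = msum N d g"
  by (simp add: msum_def)

lemma msum_zero: "(\<And>k. k < d \<Longrightarrow> f k = 0\<^sub>m N N) \<Longrightarrow> msum N d f = 0\<^sub>m N N"
  by (rule eq_matI) auto

lemma msum_minus: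
  assumes "\<And>k. k < d \<Longrightarrow> f k \<in> carrier_mat N N" "\<And>k. k < d \<Longrightarrow> g k \<in> carrier_mat N N"
  shows "msum N d (\<lambda>k. f k - g k) = msum N d f - msum N d g"
proof (rule eq_matI)
  fix i j assume "i < dim_row (msum N d f - msum N d g)" "j < dim_col (msum N d f - msum N d g)"
  then have ij: "i < N" "j < N" by auto
  have "(f k - g k) $$ (i, j) = f k $$ (i, j) - g k $$ (i, j)" if "k < d" for k
    using assms[OF that] ij by auto
  then show "msum N d (\<lambda>k. f k - g k) $$ (i, j) = (msum N d f - msum N d g) $$ (i, j)"
    using ij by (simp add: sum_subtractf)
qed auto

lemma mult_msum:
  assumes "A \<in> carrier_mat N N" "\<And>k. k < d \<Longrightarrow> f k \<in> carrier_mat N N"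
  shows "A * msum N d f = msum N d (\<lambda>k. A * f k)"
proof (rule eq_matI)
  fix i j assume "i < dim_row (msum N d (\<lambda>k. A * f k))" "j < dim_col (msum N d (\<lambda>k. A * f k))"
  then have ij: "i < N" "j < N" by auto
  have "(A * msum N d f) $$ (i, j) = (\<Sum>p<N. \<Sum>k<d. A $$ (i, p) * f k $$ (p, j))"
    using ij by (simp add: index_mult_mat_sum[OF assms(1) msum_carrier ij] sum_distrib_left)
  also have "\<dots> = (\<Sum>k<d. \<Sum>p<N. A $$ (i, p) * f k $$ (p, j))"
    by (rule sum.swap)
  also have "\<dots> = msum N d (\<lambda>k. A * f k) $$ (i, j)"
    using ij index_mult_mat_sum[OF assms(1) assms(2) ij] by simp
  finally show "(A * msum N d f) $$ (i, j) = msum N d (\<lambda>k. A * f k) $$ (i, j)" .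
qed (use assms in auto)

lemma msum_mult:
  assumes "A \<in> carrier_mat N N" "\<And>k. k < d \<Longrightarrow> f k \<in> carrier_mat N N"
  shows "msum N d f * A = msum N d (\<lambda>k. f k * A)"
proof (rule eq_matI)
  fix i j assume "i < dim_row (msum N d (\<lambda>k. f k * A))" "j < dim_col (msum N d (\<lambda>k. f k * A))"
  then have ij: "i < N" "j < N" by auto
  have "(msum N d f * A) $$ (i, j) = (\<Sum>p<N. \<Sum>k<d. f k $$ (i, p) * A $$ (p, j))"
    using ij by (simp add: index_mult_mat_sum[OF msum_carrier assms(1) ij] sum_distrib_right)
  also have "\<dots> = (\<Sum>k<d. \<Sum>p<N. f k $$ (i, p) * A $$ (p, j))"
    by (rule sum.swap)
  also have "\<dots> = msum N d (\<lambda>k. f k * A) $$ (i, j)"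
    using ij index_mult_mat_sum[OF assms(2) assms(1) ij] by simp
  finally show "(msum N d f * A) $$ (i, j) = msum N d (\<lambda>k. f k * A) $$ (i, j)" .
qed (use assms in auto)

text \<open>The outer factors may be rectangular, as the compressions of a weight to its blocks
  require.\<close>

lemma index_sandwich:
  assumes "A \<in> carrier_mat n N" "W \<in> carrier_mat N N" "B \<in> carrier_mat m N" "i < n" "j < m"
  shows "(A * W * mat_adjoint B) $$ (i, j)
    = (\<Sum>q<N. \<Sum>p<N. A $$ (i, p) * W $$ (p, q) * cnj (B $$ (j, q)))"
  unfolding index_mult_mat_sum[OF mult_carrier_mat[OF assms(1,2)] mat_adjoint_carrier[OF assms(3)] assms(4,5)]
  using assms by (simp add: index_mult_mat_sum[OF assms(1,2,4)] conjugate_complex_def sum_distrib_right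
      del: index_mult_mat)

section \<open>Moments of a weight and integrals of matrix polynomials\<close>

definition moment :: "ereal \<Rightarrow> ereal \<Rightarrow> nat \<Rightarrow> (real \<Rightarrow> complex mat) \<Rightarrow> nat \<Rightarrow> complex mat" where
  "moment a b N W n = mat_integral a b N (\<lambda>x. complex_of_real x ^ n \<cdot>\<^sub>m W x)"

text \<open>A matrix polynomial is given here by its sequence of constant coefficient matrices.
  \<open>d\<close> counts the coefficients, so the degree is below \<open>d\<close> and
  \<open>d = 0\<close> is the zero polynomial.\<close>

definition mat_poly_eval :: "nat \<Rightarrow> nat \<Rightarrow> (nat \<Rightarrow> complex mat) \<Rightarrow> real \<Rightarrow> complex mat" where
  "mat_poly_eval N d A x = msum N d (\<lambda>j. complex_of_real x ^ j \<cdot>\<^sub>m A j)"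

lemma mat_poly_eval_carrier [simp]: "mat_poly_eval N d A x \<in> carrier_mat N N"
  by (simp add: mat_poly_eval_def)

lemma moment_carrier [simp]: "moment a b N W n \<in> carrier_mat N N"
  by (simp add: moment_def mat_integral_def)

lemma dim_moment [simp]: "dim_row (moment a b N W n) = N" "dim_col (moment a b N W n) = N"
  by (simp_all add: moment_def mat_integral_def)

lemma set_integrable_sum:
  fixes f :: "'i \<Rightarrow> 'a \<Rightarrow> complex"
  assumes "\<And>i. i \<in> A \<Longrightarrow> set_integrable M S (f i)"
  shows "set_integrable M S (\<lambda>x. \<Sum>i\<in>A. f i x)"
  using assms unfolding set_integrable_def by (simp add: scaleR_sum_right)

lemma set_integral_sum:
  fixes f :: "'i \<Rightarrow> 'a \<Rightarrow> complex"
  assumes "\<And>i. i \<in> A \<Longrightarrow> set_integrable M S (f i)"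
  shows "set_lebesgue_integral M S (\<lambda>x. \<Sum>i\<in>A. f i x) = (\<Sum>i\<in>A. set_lebesgue_integral M S (f i))"
  using assms unfolding set_integrable_def set_lebesgue_integral_def
  by (simp add: scaleR_sum_right)

lemma weight_carrier: "matrix_weight a b N W \<Longrightarrow> x \<in> einterval a b \<Longrightarrow> W x \<in> carrier_mat N N"
  by (auto simp: matrix_weight_def pos_semidef_def)

lemma weight_adjoint: "matrix_weight a b N W \<Longrightarrow> x \<in> einterval a b \<Longrightarrow> mat_adjoint (W x) = W x"
  by (auto simp: matrix_weight_def pos_semidef_def)

lemma weight_integrable:
  assumes W: "matrix_weight a b N W" and "i < N" "j < N"
  shows "set_integrable lebesgue (einterval a b) (\<lambda>x. complex_of_real x ^ n * W x $$ (i, j))"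
proof -
  have "set_integrable lebesgue (einterval a b) (\<lambda>x. (complex_of_real x ^ n \<cdot>\<^sub>m W x) $$ (i, j))"
    using assms by (auto simp: matrix_weight_def mat_integrable_def)
  moreover have "(complex_of_real x ^ n \<cdot>\<^sub>m W x) $$ (i, j) = complex_of_real x ^ n * W x $$ (i, j)"
    if "x \<in> einterval a b" for x
    using weight_carrier[OF W that] assms by auto
  ultimately show ?thesis
    by (simp cong: set_integrable_cong)
qed

lemma index_moment:
  assumes W: "matrix_weight a b N W" and "i < N" "j < N"
  shows "moment a b N W n $$ (i, j)
    = set_lebesgue_integral lebesgue (einterval a b) (\<lambda>x. complex_of_real x ^ n * W x $$ (i, j))"
proof -
  have "(complex_of_real x ^ n \<cdot>\<^sub>m W x) $$ (i, j) = complex_of_real x ^ n * W x $$ (i, j)"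
    if "x \<in> einterval a b" for x
    using weight_carrier[OF W that] assms by auto
  then show ?thesis
    using assms unfolding moment_def mat_integral_def
    by (auto intro!: set_lebesgue_integral_cong)
qed

lemma mat_adjoint_moment:
  assumes W: "matrix_weight a b N W"
  shows "mat_adjoint (moment a b N W n) = moment a b N W n"
proof (rule eq_matI)
  fix i j assume "i < dim_row (moment a b N W n)" "j < dim_col (moment a b N W n)"
  then have ij: "i < N" "j < N" by auto
  have eq: "cnj (complex_of_real x ^ n * W x $$ (j, i)) = complex_of_real x ^ n * W x $$ (i, j)"
    if "x \<in> einterval a b" for x
  proof -
    have "W x $$ (i, j) = mat_adjoint (W x) $$ (i, j)"
      using weight_adjoint[OF W that] by simp
    also have "\<dots> = cnj (W x $$ (j, i))"
      using weight_carrier[OF W that] ij by (simp add: conjugate_complex_def)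
    finally show ?thesis by simp
  qed
  have "mat_adjoint (moment a b N W n) $$ (i, j) = cnj (moment a b N W n $$ (j, i))"
    using ij by (simp add: conjugate_complex_def)
  also have "\<dots> = set_lebesgue_integral lebesgue (einterval a b) (\<lambda>x. cnj (complex_of_real x ^ n * W x $$ (j, i)))"
    unfolding index_moment[OF W ij(2,1)] set_lebesgue_integral_def
    by (simp flip: Bochner_Integration.integral_cnj)
  also have "\<dots> = moment a b N W n $$ (i, j)"
    unfolding index_moment[OF W ij] by (rule set_lebesgue_integral_cong) (use eq in auto)
  finally show "mat_adjoint (moment a b N W n) $$ (i, j) = moment a b N W n $$ (i, j)" .
qed auto

text \<open>The order of summation is chosen for the next step: after integration the innermost sums
  over \<open>p\<close> and \<open>j\<close> recombine into products of a coefficient with a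
  moment.\<close>

lemma index_poly_sandwich:
  assumes A: "\<And>j. j < d \<Longrightarrow> A j \<in> carrier_mat N N" and B: "\<And>k. k < e \<Longrightarrow> B k \<in> carrier_mat N N"
    and W: "W \<in> carrier_mat N N" and il: "i < N" "l < N"
  shows "(mat_poly_eval N d A x * W * mat_adjoint (mat_poly_eval N e B x)) $$ (i, l)
    = (\<Sum>k<e. \<Sum>q<N. \<Sum>j<d. \<Sum>p<N. (A j $$ (i, p) * cnj (B k $$ (l, q))) *
         (complex_of_real x ^ (j + k) * W $$ (p, q)))"
proof -
  let ?t = "\<lambda>p q j k. (A j $$ (i, p) * cnj (B k $$ (l, q))) * (complex_of_real x ^ (j + k) * W $$ (p, q))"
  have evA: "mat_poly_eval N d A x $$ (i, p) = (\<Sum>j<d. complex_of_real x ^ j * A j $$ (i, p))"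
    if "p < N" for p
    unfolding mat_poly_eval_def using A[THEN carrier_matD(1)] A[THEN carrier_matD(2)] that il
    by simp
  have evB: "mat_poly_eval N e B x $$ (l, q) = (\<Sum>k<e. complex_of_real x ^ k * B k $$ (l, q))"
    if "q < N" for q
    unfolding mat_poly_eval_def using B[THEN carrier_matD(1)] B[THEN carrier_matD(2)] that il
    by simp
  have "(mat_poly_eval N d A x * W * mat_adjoint (mat_poly_eval N e B x)) $$ (i, l)
    = (\<Sum>q<N. \<Sum>p<N. \<Sum>j<d. \<Sum>k<e. ?t p q j k)"
    unfolding index_sandwich[OF mat_poly_eval_carrier W mat_poly_eval_carrier il]
    by (intro sum.cong refl)
      (simp add: evA evB sum_distrib_left sum_distrib_right power_add mult_ac)
  also have "\<dots> = (\<Sum>q<N. \<Sum>p<N. \<Sum>k<e. \<Sum>j<d. ?t p q j k)"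
    by (intro sum.cong refl sum.swap)
  also have "\<dots> = (\<Sum>q<N. \<Sum>k<e. \<Sum>p<N. \<Sum>j<d. ?t p q j k)"
    by (intro sum.cong refl sum.swap)
  also have "\<dots> = (\<Sum>k<e. \<Sum>q<N. \<Sum>p<N. \<Sum>j<d. ?t p q j k)"
    by (rule sum.swap)
  also have "\<dots> = (\<Sum>k<e. \<Sum>q<N. \<Sum>j<d. \<Sum>p<N. ?t p q j k)"
    by (intro sum.cong refl sum.swap)
  finally show ?thesis .
qed

context
  fixes a b N W
  assumes W: "matrix_weight a b N W"
begin

lemma poly_sandwich_integrable:
  assumes A: "\<And>j. j < d \<Longrightarrow> A j \<in> carrier_mat N N" and B: "\<And>k. k < e \<Longrightarrow> B k \<in> carrier_mat N N"
    and il: "i < N" "l < N"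
  shows "set_integrable lebesgue (einterval a b)
    (\<lambda>x. (mat_poly_eval N d A x * W x * mat_adjoint (mat_poly_eval N e B x)) $$ (i, l))"
  by (subst set_integrable_cong[OF refl refl index_poly_sandwich[OF A B weight_carrier[OF W] il]])
    (auto intro!: set_integrable_sum set_integrable_mult_right weight_integrable[OF W])

text \<open>Reduces the matrix-valued inner product of two polynomials to algebra with the moments
  \<open>moment a b N W (j + k)\<close>, a block Hankel form. Both orthogonality and definiteness
  are used through this formula.\<close>

lemma mat_integral_poly_sandwich:
  assumes A: "\<And>j. j < d \<Longrightarrow> A j \<in> carrier_mat N N" and B: "\<And>k. k < e \<Longrightarrow> B k \<in> carrier_mat N N"
  shows "mat_integral a b N (\<lambda>x. mat_poly_eval N d A x * W x * mat_adjoint (mat_poly_eval N e B x))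
    = msum N e (\<lambda>k. msum N d (\<lambda>j. A j * moment a b N W (j + k)) * mat_adjoint (B k))" (is "?L = ?R")
proof (rule eq_matI)
  fix i l assume "i < dim_row ?R" "l < dim_col ?R"
  then have il: "i < N" "l < N" by auto
  let ?c = "\<lambda>p q j k. A j $$ (i, p) * cnj (B k $$ (l, q))"
  have "?L $$ (i, l) = set_lebesgue_integral lebesgue (einterval a b)
     (\<lambda>x. (\<Sum>k<e. \<Sum>q<N. \<Sum>j<d. \<Sum>p<N. ?c p q j k * (complex_of_real x ^ (j + k) * W x $$ (p, q))))"
    unfolding mat_integral_def using il
    by (simp, intro set_lebesgue_integral_cong)
      (auto simp: index_poly_sandwich[OF A B weight_carrier[OF W] il])
  also have "\<dots> = (\<Sum>k<e. \<Sum>q<N. \<Sum>j<d. \<Sum>p<N. ?c p q j k * moment a b N W (j + k) $$ (p, q))"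
    by (intro trans[OF set_integral_sum] sum.cong refl set_integrable_sum)
      (simp_all add: weight_integrable[OF W] index_moment[OF W])
  also have "\<dots> = (\<Sum>k<e. \<Sum>q<N. (\<Sum>j<d. (A j * moment a b N W (j + k)) $$ (i, q)) * cnj (B k $$ (l, q)))"
    using index_mult_mat_sum[OF A moment_carrier il(1)]
    by (intro sum.cong refl) (simp add: sum_distrib_left sum_distrib_right mult_ac)
  also have "\<dots> = (\<Sum>k<e. (msum N d (\<lambda>j. A j * moment a b N W (j + k)) * mat_adjoint (B k)) $$ (i, l))"
  proof (intro sum.cong refl)
    fix k assume "k \<in> {..<e}"
    then have Bk: "B k \<in> carrier_mat N N" using B by simp
    show "(\<Sum>q<N. (\<Sum>j<d. (A j * moment a b N W (j + k)) $$ (i, q)) * cnj (B k $$ (l, q)))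
      = (msum N d (\<lambda>j. A j * moment a b N W (j + k)) * mat_adjoint (B k)) $$ (i, l)"
      unfolding index_mult_mat_sum[OF msum_carrier mat_adjoint_carrier[OF Bk] il]
      using il Bk by (intro sum.cong refl) (simp add: conjugate_complex_def del: index_mult_mat)
  qed
  also have "\<dots> = ?R $$ (i, l)"
    using il by (simp del: index_mult_mat)
  finally show "?L $$ (i, l) = ?R $$ (i, l)" .
qed (auto simp: mat_integral_def)

end

section \<open>Commutant and moments\<close>

text \<open>Lets positivity, which is stated through vectors, act on diagonal entries of
  congruences. The vector \<open>v\<close> is column \<open>i\<close> of
  \<open>mat_adjoint F\<close>.\<close>

lemma sandwich_diag:
  assumes F: "F \<in> carrier_mat N N" and W: "W \<in> carrier_mat N N" and i: "i < N"
  defines "v \<equiv> Matrix.vec N (\<lambda>q. cnj (F $$ (i, q)))"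
  shows "(F * W * mat_adjoint F) $$ (i, i) = (W *\<^sub>v v) \<bullet>c v"
proof -
  have "(W *\<^sub>v v) $ p = (\<Sum>q<N. W $$ (p, q) * cnj (F $$ (i, q)))" if "p < N" for p
    using W that by (auto simp: v_def scalar_prod_def lessThan_atLeast0)
  then have "(W *\<^sub>v v) \<bullet>c v = (\<Sum>p<N. (\<Sum>q<N. W $$ (p, q) * cnj (F $$ (i, q))) * F $$ (i, p))"
    using W by (simp add: v_def scalar_prod_def lessThan_atLeast0 conjugate_complex_def
        del: index_mult_mat_vec)
  also have "\<dots> = (\<Sum>p<N. \<Sum>q<N. F $$ (i, p) * W $$ (p, q) * cnj (F $$ (i, q)))"
    by (simp add: sum_distrib_left sum_distrib_right mult_ac)
  also have "\<dots> = (\<Sum>q<N. \<Sum>p<N. F $$ (i, p) * W $$ (p, q) * cnj (F $$ (i, q)))"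
    by (rule sum.swap)
  finally show ?thesis
    unfolding index_sandwich[OF F W F i i] by simp
qed

text \<open>A finite set is null, a nonempty open interval is not. This supplies the infinitely many
  zeros that kill a polynomial, and later a single point at which several almost everywhere
  properties hold together.\<close>

lemma infinite_of_AE_einterval:
  assumes "a < b" and ae: "AE x in lebesgue. x \<in> einterval a b \<longrightarrow> Q x"
  shows "infinite {x \<in> einterval a b. Q x}"
proof
  assume "finite {x \<in> einterval a b. Q x}"
  then have "{x \<in> einterval a b. Q x} \<in> null_sets lebesgue"
    using negligible_finite negligible_iff_null_sets by blast
  then have "AE x in lebesgue. x \<notin> {x \<in> einterval a b. Q x}"
    by (rule AE_not_in)
  with ae have "AE x in lebesgue. x \<notin> einterval a b"
    by eventually_elim auto
  then have "negligible (einterval a b)"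
    unfolding negligible_iff_null_sets by (subst AE_iff_null_sets) auto
  moreover have "einterval a b \<noteq> {}"
    using einterval_nonempty[OF \<open>a < b\<close>] by blast
  ultimately show False
    using open_not_negligible open_einterval by blast
qed

text \<open>Each entry is an ordinary polynomial with infinitely many roots.\<close>

lemma mat_poly_eval_eq_0_imp:
  assumes A: "\<And>j. j < d \<Longrightarrow> A j \<in> carrier_mat N N"
    and inf: "infinite {x. mat_poly_eval N d A x = 0\<^sub>m N N}" and j: "j < d"
  shows "A j = 0\<^sub>m N N"
proof (rule eq_matI)
  fix i q assume "i < dim_row (0\<^sub>m N N :: complex mat)" "q < dim_col (0\<^sub>m N N :: complex mat)"
  then have iq: "i < N" "q < N" by auto
  define p where "p = (\<Sum>j<d. monom (A j $$ (i, q)) j)"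
  have p_eval: "poly p (complex_of_real x) = mat_poly_eval N d A x $$ (i, q)" for x
  proof -
    have "(complex_of_real x ^ j \<cdot>\<^sub>m A j) $$ (i, q) = A j $$ (i, q) * complex_of_real x ^ j"
      if "j < d" for j
      using A[OF that] iq by simp
    then show ?thesis
      using iq by (simp add: p_def mat_poly_eval_def poly_sum poly_monom)
  qed
  have "infinite (complex_of_real ` {x. mat_poly_eval N d A x = 0\<^sub>m N N})"
    using inf by (simp add: finite_image_iff inj_on_def)
  then have "infinite {z. poly p z = 0}"
    by (rule infinite_super[rotated]) (use p_eval iq in auto)
  then have "p = 0"
    using poly_roots_finite by blast
  moreover have "coeff p j = A j $$ (i, q)"
    using j by (simp add: p_def coeff_sum if_distrib cong: if_cong)
  ultimately show "A j $$ (i, q) = 0\<^sub>m N N $$ (i, q)"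
    using iq by simp
qed (use A[OF j] in auto)

text \<open>The diagonal entries of the integrand are nonnegative with zero integral, hence vanish
  almost everywhere. Where \<open>W x\<close> is positive definite this annihilates every row of the
  polynomial, which therefore has infinitely many zeros.\<close>

lemma weight_definite:
  assumes W: "matrix_weight a b N W" and A: "\<And>j. j < d \<Longrightarrow> A j \<in> carrier_mat N N"
    and zero: "mat_integral a b N
      (\<lambda>x. mat_poly_eval N d A x * W x * mat_adjoint (mat_poly_eval N d A x)) = 0\<^sub>m N N"
    and j: "j < d"
  shows "A j = 0\<^sub>m N N"
proof -
  let ?F = "mat_poly_eval N d A" and ?I = "einterval a b"
  let ?g = "\<lambda>i x. (?F x * W x * mat_adjoint (?F x)) $$ (i, i)"
  let ?v = "\<lambda>i x. Matrix.vec N (\<lambda>q. cnj (?F x $$ (i, q)))"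
  have row: "AE x in lebesgue. x \<in> ?I \<longrightarrow> (\<forall>q<N. ?F x $$ (i, q) = 0)" if i: "i < N" for i
  proof -
    let ?f = "\<lambda>x. indicator ?I x *\<^sub>R ?g i x"
    have int: "integrable lebesgue ?f"
      using poly_sandwich_integrable[OF W A A i i] by (simp add: set_integrable_def)
    have quad: "?g i x = (W x *\<^sub>v ?v i x) \<bullet>c ?v i x" if "x \<in> ?I" for x
      using sandwich_diag[OF mat_poly_eval_carrier weight_carrier[OF W that] i] .
    have "0 \<le> ?g i x" if "x \<in> ?I" for x
      using W that unfolding quad[OF that] by (auto simp: matrix_weight_def pos_semidef_def)
    then have nonneg: "0 \<le> Re (?f x)" for x
      by (auto simp: indicator_def less_eq_complex_def)
    have "(\<integral>x. ?f x \<partial>lebesgue) = 0"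
      using arg_cong[OF zero, of "\<lambda>M. M $$ (i, i)"] i
      by (simp add: mat_integral_def set_lebesgue_integral_def)
    then have "(\<integral>x. Re (?f x) \<partial>lebesgue) = 0"
      using integral_Re[OF int] by simp
    then have "AE x in lebesgue. Re (?f x) = 0"
      using integral_nonneg_eq_0_iff_AE[OF integrable_Re[OF int]] nonneg by auto
    moreover have "AE x in lebesgue. x \<in> ?I \<longrightarrow> pos_def N (W x)"
      using W by (simp add: matrix_weight_def)
    ultimately show ?thesis
    proof eventually_elim
      case (elim x)
      show ?case
      proof
        assume x: "x \<in> ?I"
        \<comment> \<open>In the order on complex numbers, \<open>0 < z\<close> forces a positive
          real part, so a vanishing real part is enough.\<close>
        then have "\<not> 0 < (W x *\<^sub>v ?v i x) \<bullet>c ?v i x"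
          using elim(1) quad[OF x] by (simp add: less_complex_def)
        then have "?v i x = 0\<^sub>v N"
          using elim(2) x by (auto simp: pos_def_def)
        then have "\<And>q. q < N \<Longrightarrow> ?v i x $ q = 0" by simp
        then show "\<forall>q<N. ?F x $$ (i, q) = 0" by simp
      qed
    qed
  qed
  have "AE x in lebesgue. \<forall>i\<in>{..<N}. x \<in> ?I \<longrightarrow> (\<forall>q<N. ?F x $$ (i, q) = 0)"
    using row by (intro AE_finite_allI) auto
  then have "AE x in lebesgue. x \<in> ?I \<longrightarrow> ?F x = 0\<^sub>m N N"
    by eventually_elim (auto intro!: eq_matI simp: mat_poly_eval_def)
  then have "infinite {x \<in> ?I. ?F x = 0\<^sub>m N N}"
    using W by (intro infinite_of_AE_einterval) (auto simp: matrix_weight_def)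
  then have "infinite {x. ?F x = 0\<^sub>m N N}"
    by (rule infinite_super[rotated]) auto
  then show ?thesis
    using mat_poly_eval_eq_0_imp[of d A N j] A j by blast
qed

section \<open>Coefficients of the orthogonal polynomials and the commutant\<close>

lemma coeff_mat_carrier [simp]: "P \<in> carrier_mat n m \<Longrightarrow> coeff_mat P k \<in> carrier_mat n m"
  by (simp add: coeff_mat_def)

lemma eval_mat_monic:
  assumes "monic_mat_poly N n P"
  shows "eval_mat P x = mat_poly_eval N (Suc n) (coeff_mat P) x"
proof (rule eq_matI)
  have P: "P \<in> carrier_mat N N" using assms by (simp add: monic_mat_poly_def)
  fix i j assume "i < dim_row (mat_poly_eval N (Suc n) (coeff_mat P) x)"
    "j < dim_col (mat_poly_eval N (Suc n) (coeff_mat P) x)"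
  then have ij: "i < N" "j < N" by (auto simp: mat_poly_eval_def)
  let ?p = "P $$ (i, j)" and ?z = "complex_of_real x"
  have "coeff ?p k = 0" if "k > n" for k
  proof -
    have "coeff ?p k = coeff_mat P k $$ (i, j)" using P ij by (simp add: coeff_mat_def)
    also have "\<dots> = 0" using assms that ij by (simp add: monic_mat_poly_def)
    finally show ?thesis .
  qed
  then have deg: "degree ?p \<le> n" by (intro degree_le) auto
  have "poly ?p ?z = (\<Sum>k\<le>degree ?p. coeff ?p k * ?z ^ k)" by (rule poly_altdef)
  also have "\<dots> = (\<Sum>k\<le>n. coeff ?p k * ?z ^ k)"
    using deg by (intro sum.mono_neutral_left) (auto simp: coeff_eq_0)
  finally show "eval_mat P x $$ (i, j) = mat_poly_eval N (Suc n) (coeff_mat P) x $$ (i, j)"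
    using P ij by (simp add: eval_mat_def mat_poly_eval_def coeff_mat_def lessThan_Suc_atMost mult.commute)
qed (use assms in \<open>auto simp: eval_mat_def mat_poly_eval_def monic_mat_poly_def\<close>)

lemma minus_eq_0_imp_eq:
  fixes A B :: "complex mat"
  assumes "A \<in> carrier_mat n m" "B \<in> carrier_mat n m" "A - B = 0\<^sub>m n m"
  shows "A = B"
proof (rule eq_matI)
  fix i j assume "i < dim_row B" "j < dim_col B"
  then have ij: "i < n" "j < m" using assms by auto
  have "(A - B) $$ (i, j) = 0" using assms(3) ij by simp
  then show "A $$ (i, j) = B $$ (i, j)" using assms(1,2) ij by simp
qed (use assms in auto)

lemma smult_minus_distrib_mat:
  fixes A B :: "complex mat"
  assumes "A \<in> carrier_mat n m" "B \<in> carrier_mat n m"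
  shows "c \<cdot>\<^sub>m (A - B) = c \<cdot>\<^sub>m A - c \<cdot>\<^sub>m B"
  using assms by (intro eq_matI) (auto simp: algebra_simps)

text \<open>Turns commutation of \<open>T\<close> with a polynomial into the vanishing of another
  polynomial, to which the identity principle applies.\<close>

lemma mat_poly_eval_commutator:
  assumes T: "T \<in> carrier_mat N N" and A: "\<And>j. A j \<in> carrier_mat N N"
  shows "mat_poly_eval N d (\<lambda>j. T * A j - A j * T) x = T * mat_poly_eval N d A x - mat_poly_eval N d A x * T"
proof -
  let ?f = "\<lambda>j. complex_of_real x ^ j \<cdot>\<^sub>m A j"
  have f: "?f j \<in> carrier_mat N N" for j using A by simp
  have "complex_of_real x ^ j \<cdot>\<^sub>m (T * A j - A j * T) = T * ?f j - ?f j * T" for j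
    unfolding mult_smult_distrib[OF T A] mult_smult_assoc_mat[OF A T]
    by (rule smult_minus_distrib_mat[OF mult_carrier_mat[OF T A] mult_carrier_mat[OF A T]])
  then show ?thesis
    unfolding mat_poly_eval_def mult_msum[OF T f] msum_mult[OF T f]
    by (simp only:) (intro msum_minus mult_carrier_mat[OF T f] mult_carrier_mat[OF f T])
qed

context
  fixes a b N W P
  assumes W: "matrix_weight a b N W" and P: "monic_orthogonal_polys a b N W P"
begin

lemma monic_P: "monic_mat_poly N n (P n)"
  using P by (simp add: monic_orthogonal_polys_def)

lemma coeff_P_carrier [simp]: "coeff_mat (P n) j \<in> carrier_mat N N"
  using monic_P[of n] by (simp add: monic_mat_poly_def)

lemma coeff_P_lead [simp]: "coeff_mat (P n) n = 1\<^sub>m N"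
  using monic_P[of n] by (simp add: monic_mat_poly_def)

text \<open>Orthogonality to the monic polynomials of lower degree amounts to orthogonality to the
  lower powers of \<open>x\<close>: in the product with \<open>P m\<close> the induction hypothesis
  removes all terms but the leading one, whose coefficient is the identity.\<close>

lemma moment_orthogonality:
  assumes "k < n"
  shows "msum N (Suc n) (\<lambda>j. coeff_mat (P n) j * moment a b N W (j + k)) = 0\<^sub>m N N"
  using assms
proof (induction k rule: less_induct)
  case (less m)
  let ?G = "\<lambda>k. msum N (Suc n) (\<lambda>j. coeff_mat (P n) j * moment a b N W (j + k))"
  have "0\<^sub>m N N = mat_integral a b N (\<lambda>x. eval_mat (P n) x * W x * mat_adjoint (eval_mat (P m) x))"
    using P less.prems by (simp add: monic_orthogonal_polys_def)
  also have "\<dots> = msum N (Suc m) (\<lambda>k. ?G k * mat_adjoint (coeff_mat (P m) k))"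
    unfolding eval_mat_monic[OF monic_P] by (rule mat_integral_poly_sandwich[OF W]) auto
  also have "\<dots> = msum N m (\<lambda>k. ?G k * mat_adjoint (coeff_mat (P m) k)) + ?G m * mat_adjoint (coeff_mat (P m) m)"
    by (rule msum_Suc) (intro mult_carrier_mat[of _ N N] mat_adjoint_carrier coeff_P_carrier msum_carrier)
  also have "msum N m (\<lambda>k. ?G k * mat_adjoint (coeff_mat (P m) k)) = 0\<^sub>m N N"
  proof (rule msum_zero)
    fix k assume "k < m"
    then have "?G k = 0\<^sub>m N N" using less by simp
    then show "?G k * mat_adjoint (coeff_mat (P m) k) = 0\<^sub>m N N"
      by (simp add: left_mult_zero_mat[OF mat_adjoint_carrier[OF coeff_P_carrier]])
  qed
  also have "?G m * mat_adjoint (coeff_mat (P m) m) = ?G m"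
    by (simp add: right_mult_one_mat[OF msum_carrier])
  also have "0\<^sub>m N N + ?G m = ?G m"
    by (rule left_add_zero_mat[OF msum_carrier])
  finally show ?case by simp
qed

text \<open>One direction is the identity principle for the polynomial whose coefficients are the
  commutators, the other is linearity.\<close>

lemma commutant_iff_coeffs:
  assumes T: "T \<in> carrier_mat N N"
  shows "T \<in> commutant N P \<longleftrightarrow> (\<forall>n. \<forall>j\<le>n. T * coeff_mat (P n) j = coeff_mat (P n) j * T)"
proof
  assume *: "T \<in> commutant N P"
  show "\<forall>n. \<forall>j\<le>n. T * coeff_mat (P n) j = coeff_mat (P n) j * T"
  proof (intro allI impI)
    fix n j :: nat assume j: "j \<le> n"
    let ?R = "\<lambda>j. T * coeff_mat (P n) j - coeff_mat (P n) j * T"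
    have R: "?R j \<in> carrier_mat N N" for j
      using T by (intro minus_carrier_mat mult_carrier_mat[of _ N N]) auto
    have R0: "mat_poly_eval N (Suc n) ?R x = 0\<^sub>m N N" for x
    proof -
      have "mat_poly_eval N (Suc n) ?R x = T * eval_mat (P n) x - eval_mat (P n) x * T"
        unfolding eval_mat_monic[OF monic_P] by (rule mat_poly_eval_commutator[OF T]) simp
      also have "\<dots> = 0\<^sub>m N N"
        using * T minus_r_inv_mat[OF mult_carrier_mat[OF mat_poly_eval_carrier T]]
        by (simp add: commutant_def eval_mat_monic[OF monic_P])
      finally show ?thesis .
    qed
    have "?R j = 0\<^sub>m N N"
      using j by (intro mat_poly_eval_eq_0_imp[where d = "Suc n", OF R]) (auto simp: R0 infinite_UNIV_char_0)
    then show "T * coeff_mat (P n) j = coeff_mat (P n) j * T"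
      by (rule minus_eq_0_imp_eq[OF mult_carrier_mat[OF T coeff_P_carrier] mult_carrier_mat[OF coeff_P_carrier T]])
  qed
next
  assume *: "\<forall>n. \<forall>j\<le>n. T * coeff_mat (P n) j = coeff_mat (P n) j * T"
  have "T * eval_mat (P n) x = eval_mat (P n) x * T" for n x
  proof -
    let ?f = "\<lambda>j. complex_of_real x ^ j \<cdot>\<^sub>m coeff_mat (P n) j"
    have "T * eval_mat (P n) x = msum N (Suc n) (\<lambda>j. T * ?f j)"
      unfolding eval_mat_monic[OF monic_P] mat_poly_eval_def by (rule mult_msum[OF T]) simp
    also have "\<dots> = msum N (Suc n) (\<lambda>j. ?f j * T)"
      using * T by (intro msum_cong)
        (simp add: mult_smult_distrib[OF T coeff_P_carrier] mult_smult_assoc_mat[OF coeff_P_carrier T])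
    also have "\<dots> = eval_mat (P n) x * T"
      unfolding eval_mat_monic[OF monic_P] mat_poly_eval_def by (rule msum_mult[OF T, symmetric]) simp
    finally show ?thesis .
  qed
  then show "T \<in> commutant N P"
    using T by (simp add: commutant_def)
qed

text \<open>The commutator of \<open>T\<close> with \<open>P n\<close> has degree below
  \<open>n\<close>, yet it inherits from \<open>P n\<close> the orthogonality to all powers below
  \<open>n\<close>. It is thus orthogonal to itself and vanishes by definiteness.\<close>

lemma commutant_of_moments:
  assumes T: "T \<in> carrier_mat N N"
    and comm: "\<And>n. T * moment a b N W n = moment a b N W n * mat_adjoint T"
  shows "T \<in> commutant N P"
proof -
  {
    fix n
    let ?c = "coeff_mat (P n)" and ?m = "moment a b N W"
    let ?R = "\<lambda>j. T * ?c j - ?c j * T"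
    have R: "?R j \<in> carrier_mat N N" for j
      using T by (intro minus_carrier_mat mult_carrier_mat[of _ N N]) auto
    \<comment> \<open>The leading coefficient is the identity, so the degree of the commutator drops
      below \<open>n\<close>.\<close>
    have Rn: "?R n = 0\<^sub>m N N"
      using T by simp
    have sum_R: "msum N n (\<lambda>j. ?R j * ?m (j + k)) = 0\<^sub>m N N" if "k < n" for k
    proof -
      have cm: "?c j * ?m (j + k) \<in> carrier_mat N N" for j
        by (intro mult_carrier_mat[of _ N N]) auto
      have "?R j * ?m (j + k) = T * (?c j * ?m (j + k)) - (?c j * ?m (j + k)) * mat_adjoint T" for j
      proof -
        have "?R j * ?m (j + k) = T * ?c j * ?m (j + k) - ?c j * T * ?m (j + k)"
          by (rule minus_mult_distrib_mat[OF mult_carrier_mat[OF T coeff_P_carrier]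
                mult_carrier_mat[OF coeff_P_carrier T] moment_carrier])
        also have "T * ?c j * ?m (j + k) = T * (?c j * ?m (j + k))"
          by (rule assoc_mult_mat[OF T coeff_P_carrier moment_carrier])
        also have "?c j * T * ?m (j + k) = ?c j * (T * ?m (j + k))"
          by (rule assoc_mult_mat[OF coeff_P_carrier T moment_carrier])
        \<comment> \<open>The hypothesis moves \<open>T\<close> through the moment to the far right,
          where it becomes a constant factor of the whole orthogonality sum.\<close>
        also have "\<dots> = ?c j * ?m (j + k) * mat_adjoint T"
          unfolding comm
          by (rule assoc_mult_mat[OF coeff_P_carrier moment_carrier mat_adjoint_carrier[OF T], symmetric])
        finally show ?thesis .
      qed
      then have "msum N (Suc n) (\<lambda>j. ?R j * ?m (j + k))
        = msum N (Suc n) (\<lambda>j. T * (?c j * ?m (j + k))) - msum N (Suc n) (\<lambda>j. (?c j * ?m (j + k)) * mat_adjoint T)"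
        by (simp only:)
          (rule msum_minus mult_carrier_mat[OF T cm] mult_carrier_mat[OF cm mat_adjoint_carrier[OF T]])+
      also have "\<dots> = T * msum N (Suc n) (\<lambda>j. ?c j * ?m (j + k)) - msum N (Suc n) (\<lambda>j. ?c j * ?m (j + k)) * mat_adjoint T"
        by (simp only: mult_msum[OF T cm] msum_mult[OF mat_adjoint_carrier[OF T] cm])
      also have "\<dots> = 0\<^sub>m N N"
        unfolding moment_orthogonality[OF that] using T by simp
      finally have "0\<^sub>m N N = msum N (Suc n) (\<lambda>j. ?R j * ?m (j + k))" by simp
      also have "\<dots> = msum N n (\<lambda>j. ?R j * ?m (j + k)) + ?R n * ?m (n + k)"
        by (rule msum_Suc) (rule mult_carrier_mat[OF R moment_carrier])
      also have "?R n * ?m (n + k) = 0\<^sub>m N N"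
        unfolding Rn by (rule left_mult_zero_mat[OF moment_carrier])
      also have "msum N n (\<lambda>j. ?R j * ?m (j + k)) + 0\<^sub>m N N = msum N n (\<lambda>j. ?R j * ?m (j + k))"
        by (rule right_add_zero_mat[OF msum_carrier])
      finally show ?thesis by simp
    qed
    \<comment> \<open>The square of the commutator polynomial is a combination of its products with
      powers below \<open>n\<close>, all of which are zero by \<open>sum_R\<close>.\<close>
    have "mat_integral a b N (\<lambda>x. mat_poly_eval N n ?R x * W x * mat_adjoint (mat_poly_eval N n ?R x))
      = msum N n (\<lambda>k. msum N n (\<lambda>j. ?R j * ?m (j + k)) * mat_adjoint (?R k))"
      by (intro mat_integral_poly_sandwich[OF W] R)
    also have "\<dots> = 0\<^sub>m N N"
      by (intro msum_zero) (simp only: sum_R left_mult_zero_mat[OF mat_adjoint_carrier[OF R]])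
    finally have "?R j = 0\<^sub>m N N" if "j < n" for j
      using weight_definite[where A = ?R and d = n and j = j, OF W R] that by blast
    then have "?R j = 0\<^sub>m N N" if "j \<le> n" for j
      using Rn that by (cases "j = n") auto
    then have "T * ?c j = ?c j * T" if "j \<le> n" for j
      using minus_eq_0_imp_eq[OF mult_carrier_mat[OF T coeff_P_carrier] mult_carrier_mat[OF coeff_P_carrier T]]
        that by blast
  }
  then show ?thesis
    unfolding commutant_iff_coeffs[OF T] by blast
qed

end

section \<open>Diagonalization of selfadjoint matrices\<close>

lemma mult_carrier_square [simp]:
  "A \<in> carrier_mat N N \<Longrightarrow> B \<in> carrier_mat N N \<Longrightarrow> A * B \<in> carrier_mat N N"
  by (rule mult_carrier_mat)

lemma assoc_mult_square:
  "A \<in> carrier_mat N N \<Longrightarrow> B \<in> carrier_mat N N \<Longrightarrow> C \<in> carrier_mat N N \<Longrightarrow> A * B * C = A * (B * C)"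
  by (rule assoc_mult_mat)

section \<open>Jordan form of a matrix selfadjoint with respect to a positive definite one\<close>

lemma index_jordan_matrix_Cons:
  fixes a :: complex
  assumes "i < n + sum_list (map fst n_as)" "j < n + sum_list (map fst n_as)"
  shows "jordan_matrix ((n, a) # n_as) $$ (i, j) =
    (if i < n then if j < n then jordan_block n a $$ (i, j) else 0
     else if j < n then 0 else jordan_matrix n_as $$ (i - n, j - n))"
proof -
  have "i - n < sum_list (map fst n_as)" if "\<not> i < n" using that assms by linarith
  moreover have "j - n < sum_list (map fst n_as)" if "\<not> j < n" using that assms by linarith
  ultimately show ?thesis
    using assms unfolding jordan_matrix_Cons by (subst index_mat_four_block(1)) simp_all
qed

text \<open>By induction on the list of blocks: a nonzero entry lies within a single block, whose
  diagonal is constant.\<close>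

lemma jordan_matrix_entries:
  fixes n_as :: "(nat \<times> complex) list"
  assumes "i < sum_list (map fst n_as)" "j < sum_list (map fst n_as)"
    and "jordan_matrix n_as $$ (i, j) \<noteq> 0"
  shows "j = i \<or> j = Suc i \<and> jordan_matrix n_as $$ (i, i) = jordan_matrix n_as $$ (j, j)"
  using assms
proof (induction n_as arbitrary: i j)
  case (Cons na n_as)
  obtain n a where na: "na = (n, a)" by (cases na)
  have less: "i < n + sum_list (map fst n_as)" "j < n + sum_list (map fst n_as)"
    using Cons.prems by (simp_all add: na)
  note nz = Cons.prems(3)[unfolded na index_jordan_matrix_Cons[OF less]]
  show ?case
  proof (cases "i < n")
    case True
    then have "j < n" and "jordan_block n a $$ (i, j) \<noteq> 0"
      using nz by (auto split: if_splits)
    then have "j = i \<or> j = Suc i"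
      using True by (auto split: if_splits)
    then show ?thesis
      using True \<open>j < n\<close> less
      by (auto simp: na index_jordan_matrix_Cons)
  next
    case False
    then have j: "\<not> j < n" and "jordan_matrix n_as $$ (i - n, j - n) \<noteq> 0"
      using nz by (auto split: if_splits)
    moreover have "i - n < sum_list (map fst n_as)" "j - n < sum_list (map fst n_as)"
      using less False j by linarith+
    ultimately have "j - n = i - n \<or> j - n = Suc (i - n) \<and>
        jordan_matrix n_as $$ (i - n, i - n) = jordan_matrix n_as $$ (j - n, j - n)"
      by (intro Cons.IH)
    moreover have "j - n = i - n \<Longrightarrow> j = i" "j - n = Suc (i - n) \<Longrightarrow> j = Suc i"
      using False j by linarith+
    ultimately show ?thesis
      unfolding na index_jordan_matrix_Cons[OF less(1) less(1)] index_jordan_matrix_Cons[OF less(2) less(2)]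
      using False j by auto
  qed
qed simp

text \<open>The right inverse \<open>G\<close> excludes a zero row of \<open>F\<close>, so the
  quadratic form of \<open>W\<close> is evaluated at a nonzero vector.\<close>

lemma pos_def_congruence_diag:
  assumes W: "pos_def N W" and F: "F \<in> carrier_mat N N" "G \<in> carrier_mat N N" "F * G = 1\<^sub>m N"
    and i: "i < N"
  shows "0 < (F * W * mat_adjoint F) $$ (i, i)"
proof -
  define v where "v = Matrix.vec N (\<lambda>q. cnj (F $$ (i, q)))"
  have Wc: "W \<in> carrier_mat N N" using W by (simp add: pos_def_def)
  have "v \<noteq> 0\<^sub>v N"
  proof
    assume "v = 0\<^sub>v N"
    then have "v $ q = 0" if "q < N" for q using that by simp
    then have "F $$ (i, q) = 0" if "q < N" for q using that by (simp add: v_def)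
    then have "(F * G) $$ (i, i) = 0"
      unfolding index_mult_mat_sum[OF F(1,2) i i] by simp
    then show False using F(3) i by simp
  qed
  moreover have "v \<in> carrier_vec N" by (simp add: v_def)
  ultimately have "0 < (W *\<^sub>v v) \<bullet>c v"
    using W by (simp add: pos_def_def)
  then show ?thesis
    unfolding sandwich_diag[OF F(1) Wc i] v_def .
qed

text \<open>The last off-diagonal entry of \<open>J\<close> would force a diagonal entry of \<open>V\<close> to vanish.\<close>

lemma jordan_selfadjoint_diagonal:
  assumes J: "J \<in> carrier_mat N N" and V: "V \<in> carrier_mat N N"
    and bidiag: "\<And>i j. i < N \<Longrightarrow> j < N \<Longrightarrow> J $$ (i, j) \<noteq> 0 \<Longrightarrow> j = i \<or> j = Suc i"
    and super: "\<And>i. Suc i < N \<Longrightarrow> J $$ (i, Suc i) \<noteq> 0 \<Longrightarrow> J $$ (i, i) = J $$ (Suc i, Suc i)"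
    and selfadj: "J * V = V * mat_adjoint J" and pos: "\<And>i. i < N \<Longrightarrow> 0 < V $$ (i, i)"
    and ij: "i < N" "j < N"
  shows "J $$ (i, j) = (if i = j then cnj (J $$ (i, i)) else 0)"
proof -
  have entry: "(\<Sum>p<N. J $$ (i, p) * V $$ (p, j)) = (\<Sum>p<N. V $$ (i, p) * cnj (J $$ (j, p)))"
    if ij: "i < N" "j < N" for i j
  proof -
    have "(J * V) $$ (i, j) = (\<Sum>p<N. J $$ (i, p) * V $$ (p, j))"
      using index_mult_mat_sum[OF J V that] .
    moreover have "(V * mat_adjoint J) $$ (i, j) = (\<Sum>p<N. V $$ (i, p) * cnj (J $$ (j, p)))"
      using index_mult_mat_sum[OF V mat_adjoint_carrier[OF J] that] J that
      by (simp add: conjugate_complex_def del: index_mult_mat)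
    ultimately show ?thesis using selfadj by simp
  qed
  \<comment> \<open>If row \<open>j\<close> is diagonal, the entry \<open>(j, j)\<close> of
    \<open>selfadj\<close> compares \<open>J $$ (j, j)\<close> with its conjugate, both multiplied
    by the nonzero number \<open>V $$ (j, j)\<close>.\<close>
  have real: "cnj (J $$ (j, j)) = J $$ (j, j)"
    if j: "j < N" and row: "\<And>p. p < N \<Longrightarrow> p \<noteq> j \<Longrightarrow> J $$ (j, p) = 0" for j
  proof -
    have "(\<Sum>p<N. J $$ (j, p) * V $$ (p, j)) = (\<Sum>p<N. if p = j then J $$ (j, j) * V $$ (j, j) else 0)"
      by (intro sum.cong) (auto simp: row)
    moreover have "(\<Sum>p<N. V $$ (j, p) * cnj (J $$ (j, p)))
        = (\<Sum>p<N. if p = j then V $$ (j, j) * cnj (J $$ (j, j)) else 0)"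
      by (intro sum.cong) (auto simp: row)
    ultimately show ?thesis
      using entry[OF j j] pos[OF j] j by auto
  qed
  have diag: "J $$ (i, Suc i) = 0" if i: "Suc i < N" for i
  proof (rule ccontr)
    assume nz: "J $$ (i, Suc i) \<noteq> 0"
    define S where "S = {i. Suc i < N \<and> J $$ (i, Suc i) \<noteq> 0}"
    have "S \<subseteq> {..<N}" by (auto simp: S_def)
    then have S: "finite S" "S \<noteq> {}"
      using i nz finite_subset[of S "{..<N}"] by (auto simp: S_def)
    \<comment> \<open>By maximality of \<open>m\<close>, row \<open>Suc m\<close> of
      \<open>J\<close> has only its diagonal entry, which is then real.\<close>
    define m where "m = Max S"
    have m: "Suc m < N" "J $$ (m, Suc m) \<noteq> 0" and max: "\<And>i. i \<in> S \<Longrightarrow> i \<le> m"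
      using Max_in[OF S] Max_ge[OF S(1)] by (auto simp: m_def S_def)
    have row: "J $$ (Suc m, p) = 0" if "p < N" "p \<noteq> Suc m" for p
    proof (rule ccontr)
      assume nz: "J $$ (Suc m, p) \<noteq> 0"
      then have "p = Suc (Suc m)" using bidiag[of "Suc m" p] m that by auto
      then have "Suc m \<in> S" using nz that by (simp add: S_def)
      then show False using max[of "Suc m"] by simp
    qed
    let ?l = "J $$ (Suc m, Suc m)"
    have l: "cnj ?l = ?l" using real[OF m(1) row] by simp
    have "(\<Sum>p<N. J $$ (m, p) * V $$ (p, Suc m))
      = (\<Sum>p\<in>{m, Suc m}. J $$ (m, p) * V $$ (p, Suc m))"
      using m bidiag[of m] by (intro sum.mono_neutral_right) auto
    also have "\<dots> = ?l * V $$ (m, Suc m) + J $$ (m, Suc m) * V $$ (Suc m, Suc m)"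
      using super[OF m] by simp
    finally have "(\<Sum>p<N. V $$ (m, p) * cnj (J $$ (Suc m, p)))
       = ?l * V $$ (m, Suc m) + J $$ (m, Suc m) * V $$ (Suc m, Suc m)"
      using entry[of m "Suc m"] m by simp
    moreover have "(\<Sum>p<N. V $$ (m, p) * cnj (J $$ (Suc m, p)))
        = (\<Sum>p<N. if p = Suc m then V $$ (m, Suc m) * cnj ?l else 0)"
      by (intro sum.cong) (auto simp: row)
    \<comment> \<open>Both sums express the entry \<open>(m, Suc m)\<close> of
      \<open>selfadj\<close>. Since \<open>?l\<close> is real, the terms with
      \<open>V $$ (m, Suc m)\<close> cancel.\<close>
    ultimately have "J $$ (m, Suc m) * V $$ (Suc m, Suc m) = 0"
      using m l by simp
    then show False using m pos[of "Suc m"] by auto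
  qed
  then have off: "J $$ (i, p) = 0" if "i < N" "p < N" "p \<noteq> i" for i p
    using bidiag[of i p] that by blast
  then show ?thesis using real[of i] ij by auto
qed

text \<open>Positivity excludes nontrivial Jordan blocks and makes the eigenvalues real. The rows of
  \<open>M\<close> are left eigenvectors of \<open>H\<close>, ordered so that one eigenvalue fills
  the first \<open>k\<close> places and all others come after it; a nonscalar \<open>H\<close> has
  at least two eigenvalues.\<close>

lemma diagonalize_selfadjoint:
  assumes H: "H \<in> carrier_mat N N" and W: "pos_def N W" and selfadj: "H * W = W * mat_adjoint H"
    and nonscalar: "\<not> scalar_matrix N H"
  obtains M l k where "M \<in> carrier_mat N N" "invertible_mat M" "0 < k" "k < N"
    "\<And>i j. i < N \<Longrightarrow> j < N \<Longrightarrow> (M * H) $$ (i, j) = l i * M $$ (i, j)"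
    "\<And>i. i < N \<Longrightarrow> cnj (l i) = l i"
    "\<And>i j. i < k \<Longrightarrow> k \<le> j \<Longrightarrow> j < N \<Longrightarrow> l i \<noteq> l j"
proof -
  have Wc: "W \<in> carrier_mat N N" using W by (simp add: pos_def_def)
  obtain as where "char_poly H = (\<Prod>a\<leftarrow>as. [:- a, 1:])"
    using char_poly_factorized[OF H] by blast
  then obtain n_as where "jordan_nf H n_as"
    using jordan_nf_exists[OF H] by blast
  then obtain Q R where sim: "similar_mat_wit H (jordan_matrix n_as) R Q"
    unfolding jordan_nf_def similar_mat_def by blast
  define J where "J = jordan_matrix n_as"
  have c: "J \<in> carrier_mat N N" "R \<in> carrier_mat N N" "Q \<in> carrier_mat N N"
    and RQ: "R * Q = 1\<^sub>m N" and QR: "Q * R = 1\<^sub>m N" and HJ: "H = R * J * Q"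
    using sim H unfolding similar_mat_wit_def Let_def J_def by auto
  have sum_N: "sum_list (map fst n_as) = N"
    using c(1) unfolding J_def by (metis carrier_matD(1) jordan_matrix_dim(1))
  have QH: "Q * H = J * Q"
  proof -
    have "Q * H = Q * R * (J * Q)" unfolding HJ using c by (simp add: assoc_mult_square[of _ N])
    then show ?thesis using c by (simp add: QR)
  qed
  \<comment> \<open>In Jordan coordinates \<open>W\<close> becomes \<open>V\<close>, and the
    relation between \<open>H\<close> and \<open>W\<close> becomes the same relation between
    \<open>J\<close> and \<open>V\<close>.\<close>
  define V where "V = Q * W * mat_adjoint Q"
  have Vc: "V \<in> carrier_mat N N" using c Wc by (simp add: V_def)
  have JV: "J * V = V * mat_adjoint J"
  proof -
    have "J * V = J * Q * W * mat_adjoint Q"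
      unfolding V_def using c Wc by (simp add: assoc_mult_square[of _ N])
    also have "\<dots> = Q * (H * W) * mat_adjoint Q"
      unfolding QH[symmetric] using c Wc H by (simp add: assoc_mult_square[of _ N])
    also have "\<dots> = Q * W * (mat_adjoint H * mat_adjoint Q)"
      unfolding selfadj using c Wc H by (simp add: assoc_mult_square[of _ N])
    also have "mat_adjoint H * mat_adjoint Q = mat_adjoint (J * Q)"
      using QH mat_adjoint_mult[OF c(3) H] by simp
    also have "\<dots> = mat_adjoint Q * mat_adjoint J"
      by (rule mat_adjoint_mult[OF c(1,3)])
    finally show ?thesis
      unfolding V_def using c Wc by (simp add: assoc_mult_square[of _ N])
  qed
  have J_diag: "J $$ (i, j) = (if i = j then cnj (J $$ (i, i)) else 0)" if "i < N" "j < N" for i j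
  proof (rule jordan_selfadjoint_diagonal[OF c(1) Vc _ _ JV _ that])
    show "0 < V $$ (i, i)" if "i < N" for i
      unfolding V_def using pos_def_congruence_diag[OF W c(3,2) QR that] .
    show "j = i \<or> j = Suc i" if "i < N" "j < N" "J $$ (i, j) \<noteq> 0" for i j
      using jordan_matrix_entries[of i n_as j] that by (auto simp: J_def sum_N)
    show "J $$ (i, i) = J $$ (Suc i, Suc i)" if "Suc i < N" "J $$ (i, Suc i) \<noteq> 0" for i
      using jordan_matrix_entries[of i n_as "Suc i"] that by (simp add: J_def sum_N)
  qed
  define l where "l i = J $$ (i, i)" for i
  have J_off: "J $$ (i, j) = 0" if "i < N" "j < N" "i \<noteq> j" for i j
    using J_diag[OF that(1,2)] that(3) by (simp only: if_False)
  have l_real: "cnj (l i) = l i" if "i < N" for i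
    unfolding l_def by (rule J_diag[OF that that, simplified, symmetric])
  have QH_entry: "(Q * H) $$ (i, j) = l i * Q $$ (i, j)" if "i < N" "j < N" for i j
  proof -
    have "(J * Q) $$ (i, j) = (\<Sum>p<N. if p = i then l i * Q $$ (i, j) else 0)"
      unfolding index_mult_mat_sum[OF c(1,3) that]
      using J_off[OF that(1)] that by (intro sum.cong) (auto simp: l_def)
    then show ?thesis using that by (simp add: QH)
  qed
  \<comment> \<open>With a single eigenvalue, the diagonalizable \<open>H\<close> would be
    scalar.\<close>
  have "\<exists>i<N. l i \<noteq> l 0"
  proof (rule ccontr)
    assume "\<not> (\<exists>i<N. l i \<noteq> l 0)"
    then have const: "l i = l 0" if "i < N" for i using that by blast
    have "Q * H = l 0 \<cdot>\<^sub>m Q"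
    proof (rule eq_matI)
      fix i j assume "i < dim_row (l 0 \<cdot>\<^sub>m Q)" "j < dim_col (l 0 \<cdot>\<^sub>m Q)"
      then have ij: "i < N" "j < N" using c by auto
      show "(Q * H) $$ (i, j) = (l 0 \<cdot>\<^sub>m Q) $$ (i, j)"
        unfolding QH_entry[OF ij] const[OF ij(1)] using c ij by simp
    qed (use c H in auto)
    then have "R * (Q * H) = l 0 \<cdot>\<^sub>m 1\<^sub>m N"
      using mult_smult_distrib[OF c(2,3)] by (simp add: RQ)
    moreover have "R * (Q * H) = R * Q * H"
      using c H by simp
    then have "R * (Q * H) = H"
      using H by (simp add: RQ)
    ultimately show False
      using nonscalar by (auto simp: scalar_matrix_def)
  qed
  then obtain i1 where i1: "i1 < N" "l i1 \<noteq> l 0" by blast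
  \<comment> \<open>A permutation of the indices that lists those with eigenvalue \<open>l 0\<close>
    first. It is applied below to the rows of \<open>Q\<close> and to the columns of its inverse
    \<open>R\<close>.\<close>
  define ys zs where "ys = filter (\<lambda>i. l i = l 0) [0..<N]" and "zs = filter (\<lambda>i. l i \<noteq> l 0) [0..<N]"
  define xs where "xs = ys @ zs"
  define k where "k = length ys"
  have xs: "distinct xs" "set xs = {..<N}"
    by (auto simp: xs_def ys_def zs_def)
  then have len: "length xs = N"
    by (metis card_lessThan distinct_card)
  have xs_less: "xs ! i < N" if "i < N" for i
    using nth_mem[of i xs] that xs(2) len by auto
  have ys_ne: "0 \<in> set ys" and zs_ne: "i1 \<in> set zs"
    using i1 by (auto simp: ys_def zs_def)
  have k: "0 < k" "k < N"
  proof -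
    show "0 < k" using length_pos_if_in_set[OF ys_ne] by (simp add: k_def)
    have "0 < length zs" using length_pos_if_in_set[OF zs_ne] .
    then show "k < N" using len unfolding k_def xs_def length_append by linarith
  qed
  define M where "M = Matrix.mat N N (\<lambda>(i, j). Q $$ (xs ! i, j))"
  define M' where "M' = Matrix.mat N N (\<lambda>(i, j). R $$ (i, xs ! j))"
  have Mc: "M \<in> carrier_mat N N" "M' \<in> carrier_mat N N" by (simp_all add: M_def M'_def)
  have MM': "M * M' = 1\<^sub>m N"
  proof (rule eq_matI)
    fix i j assume "i < dim_row (1\<^sub>m N :: complex mat)" "j < dim_col (1\<^sub>m N :: complex mat)"
    then have ij: "i < N" "j < N" by auto
    have "(M * M') $$ (i, j) = (Q * R) $$ (xs ! i, xs ! j)"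
      unfolding index_mult_mat_sum[OF Mc ij] index_mult_mat_sum[OF c(3,2) xs_less[OF ij(1)] xs_less[OF ij(2)]]
      using ij by (simp add: M_def M'_def)
    also have "\<dots> = 1\<^sub>m N $$ (i, j)"
      unfolding QR using ij xs len by (simp add: xs_less nth_eq_iff_index_eq)
    finally show "(M * M') $$ (i, j) = 1\<^sub>m N $$ (i, j)" .
  qed (use Mc in auto)
  show thesis
  proof (rule that[OF Mc(1) _ k, of "\<lambda>i. l (xs ! i)"])
    have "M' * M = 1\<^sub>m N" by (rule mat_mult_left_right_inverse[OF Mc MM'])
    then show "invertible_mat M"
      using MM' Mc unfolding invertible_mat_def inverts_mat_def by auto
    show "(M * H) $$ (i, j) = l (xs ! i) * M $$ (i, j)" if ij: "i < N" "j < N" for i j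
    proof -
      have "(M * H) $$ (i, j) = (Q * H) $$ (xs ! i, j)"
        unfolding index_mult_mat_sum[OF Mc(1) H ij] index_mult_mat_sum[OF c(3) H xs_less[OF ij(1)] ij(2)]
        using ij by (simp add: M_def)
      then show ?thesis
        using ij QH_entry[OF xs_less[OF ij(1)] ij(2)] by (simp add: M_def)
    qed
    show "cnj (l (xs ! i)) = l (xs ! i)" if "i < N" for i
      using l_real xs_less that by simp
    show "l (xs ! i) \<noteq> l (xs ! j)" if "i < k" "k \<le> j" "j < N" for i j
    proof -
      have "xs ! i \<in> set ys" using that by (simp add: xs_def k_def nth_append)
      moreover have "xs ! j \<in> set zs" using that len by (auto simp: xs_def k_def nth_append)
      ultimately show ?thesis by (auto simp: ys_def zs_def)
    qed
  qed
qed

section \<open>Selfadjoint elements of the commutant\<close>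

text \<open>Linearity takes the constant matrix under the integral, entry by entry. The
  integrability claims accompany the formulas because both sides are later compared almost
  everywhere or subtracted.\<close>

lemma index_moment_mult:
  assumes W: "matrix_weight a b N W" and T: "T \<in> carrier_mat N N" and ij: "i < N" "j < N"
  shows "(T * moment a b N W n) $$ (i, j) =
      set_lebesgue_integral lebesgue (einterval a b) (\<lambda>x. complex_of_real x ^ n * (T * W x) $$ (i, j))" (is ?eq_left)
    and "set_integrable lebesgue (einterval a b) (\<lambda>x. complex_of_real x ^ n * (T * W x) $$ (i, j))" (is ?int_left)
    and "(moment a b N W n * mat_adjoint T) $$ (i, j) =
      set_lebesgue_integral lebesgue (einterval a b) (\<lambda>x. complex_of_real x ^ n * (W x * mat_adjoint T) $$ (i, j))" (is ?eq_right)
    and "set_integrable lebesgue (einterval a b) (\<lambda>x. complex_of_real x ^ n * (W x * mat_adjoint T) $$ (i, j))" (is ?int_right)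
proof -
  have left: "complex_of_real x ^ n * (T * W x) $$ (i, j) = (\<Sum>p<N. T $$ (i, p) * (complex_of_real x ^ n * W x $$ (p, j)))"
    if "x \<in> einterval a b" for x
    unfolding index_mult_mat_sum[OF T weight_carrier[OF W that] ij]
    by (simp add: sum_distrib_left mult_ac)
  have right: "complex_of_real x ^ n * (W x * mat_adjoint T) $$ (i, j)
    = (\<Sum>p<N. cnj (T $$ (j, p)) * (complex_of_real x ^ n * W x $$ (i, p)))"
    if "x \<in> einterval a b" for x
    unfolding index_mult_mat_sum[OF weight_carrier[OF W that] mat_adjoint_carrier[OF T] ij]
    using T ij by (simp add: sum_distrib_left mult_ac conjugate_complex_def)
  have intl: "set_integrable lebesgue (einterval a b) (\<lambda>x. T $$ (i, p) * (complex_of_real x ^ n * W x $$ (p, j)))" if "p < N" for p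
    by (intro set_integrable_mult_right weight_integrable[OF W that ij(2)])
  have intr: "set_integrable lebesgue (einterval a b) (\<lambda>x. cnj (T $$ (j, p)) * (complex_of_real x ^ n * W x $$ (i, p)))" if "p < N" for p
    by (intro set_integrable_mult_right weight_integrable[OF W ij(1) that])
  show ?int_left
    by (subst set_integrable_cong[OF refl refl left]) (auto intro!: set_integrable_sum intl)
  show ?int_right
    by (subst set_integrable_cong[OF refl refl right]) (auto intro!: set_integrable_sum intr)
  have "(T * moment a b N W n) $$ (i, j) = (\<Sum>p<N. set_lebesgue_integral lebesgue (einterval a b)
      (\<lambda>x. T $$ (i, p) * (complex_of_real x ^ n * W x $$ (p, j))))"
    unfolding index_mult_mat_sum[OF T moment_carrier ij]
    using ij by (intro sum.cong refl) (simp add: index_moment[OF W])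
  also have "\<dots> = set_lebesgue_integral lebesgue (einterval a b)
      (\<lambda>x. \<Sum>p<N. T $$ (i, p) * (complex_of_real x ^ n * W x $$ (p, j)))"
    by (rule set_integral_sum[symmetric]) (auto intro: intl)
  also have "\<dots> = set_lebesgue_integral lebesgue (einterval a b) (\<lambda>x. complex_of_real x ^ n * (T * W x) $$ (i, j))"
    by (rule set_lebesgue_integral_cong) (use left in auto)
  finally show ?eq_left .
  have "(moment a b N W n * mat_adjoint T) $$ (i, j) = (\<Sum>p<N. set_lebesgue_integral lebesgue (einterval a b)
      (\<lambda>x. cnj (T $$ (j, p)) * (complex_of_real x ^ n * W x $$ (i, p))))"
    unfolding index_mult_mat_sum[OF moment_carrier mat_adjoint_carrier[OF T] ij]
    using ij T by (intro sum.cong refl) (simp add: index_moment[OF W] conjugate_complex_def)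
  also have "\<dots> = set_lebesgue_integral lebesgue (einterval a b)
      (\<lambda>x. \<Sum>p<N. cnj (T $$ (j, p)) * (complex_of_real x ^ n * W x $$ (i, p)))"
    by (rule set_integral_sum[symmetric]) (auto intro: intr)
  also have "\<dots> = set_lebesgue_integral lebesgue (einterval a b) (\<lambda>x. complex_of_real x ^ n * (W x * mat_adjoint T) $$ (i, j))"
    by (rule set_lebesgue_integral_cong) (use right in auto)
  finally show ?eq_right .
qed

lemma moment_commute_of_weight:
  assumes W: "matrix_weight a b N W" and T: "T \<in> carrier_mat N N"
    and comm: "AE x in lebesgue. x \<in> einterval a b \<longrightarrow> T * W x = W x * mat_adjoint T"
  shows "T * moment a b N W n = moment a b N W n * mat_adjoint T"
proof (rule eq_matI)
  fix i j assume "i < dim_row (moment a b N W n * mat_adjoint T)" "j < dim_col (moment a b N W n * mat_adjoint T)"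
  then have ij: "i < N" "j < N" using T by auto
  show "(T * moment a b N W n) $$ (i, j) = (moment a b N W n * mat_adjoint T) $$ (i, j)"
    unfolding index_moment_mult(1,3)[OF W T ij] set_lebesgue_integral_def
  proof (rule integral_cong_AE)
    show "(\<lambda>x. indicat_real (einterval a b) x *\<^sub>R (complex_of_real x ^ n * (T * W x) $$ (i, j))) \<in> borel_measurable lebesgue"
      "(\<lambda>x. indicat_real (einterval a b) x *\<^sub>R (complex_of_real x ^ n * (W x * mat_adjoint T) $$ (i, j))) \<in> borel_measurable lebesgue"
      using index_moment_mult(2,4)[OF W T ij, of n] unfolding set_integrable_def by auto
    show "AE x in lebesgue. indicat_real (einterval a b) x *\<^sub>R (complex_of_real x ^ n * (T * W x) $$ (i, j))
        = indicat_real (einterval a b) x *\<^sub>R (complex_of_real x ^ n * (W x * mat_adjoint T) $$ (i, j))"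
      using comm by eventually_elim (auto simp: indicator_def)
  qed
qed (use T in auto)

text \<open>This is where the converse uses a finite interval: every entry of
  \<open>T * W x - W x * mat_adjoint T\<close> has vanishing moments, which determine it only
  because the interval is bounded.\<close>

lemma weight_commute_of_moments:
  assumes W: "matrix_weight a b N W" and T: "T \<in> carrier_mat N N"
    and fin: "\<bar>a\<bar> \<noteq> \<infinity>" "\<bar>b\<bar> \<noteq> \<infinity>"
    and comm: "\<And>n. T * moment a b N W n = moment a b N W n * mat_adjoint T"
  shows "AE x in lebesgue. x \<in> einterval a b \<longrightarrow> T * W x = W x * mat_adjoint T"
proof -
  have entry: "AE x in lebesgue. x \<in> einterval a b \<longrightarrow> (T * W x) $$ (i, j) = (W x * mat_adjoint T) $$ (i, j)"
    if ij: "i < N" "j < N" for i j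
  proof -
    let ?f = "\<lambda>x. (T * W x) $$ (i, j) - (W x * mat_adjoint T) $$ (i, j)"
    have "AE x in lebesgue. x \<in> einterval a b \<longrightarrow> ?f x = 0"
    proof (rule AE_eq_0_of_moments[OF _ fin])
      show "set_integrable lebesgue (einterval a b) ?f"
        using set_integral_diff(1)[OF index_moment_mult(2,4)[OF W T ij, of 0]] by simp
      fix n
      have "set_lebesgue_integral lebesgue (einterval a b) (\<lambda>x. complex_of_real x ^ n * ?f x)
        = (T * moment a b N W n) $$ (i, j) - (moment a b N W n * mat_adjoint T) $$ (i, j)"
        unfolding index_moment_mult(1,3)[OF W T ij] right_diff_distrib
        by (rule set_integral_diff(2)[OF index_moment_mult(2,4)[OF W T ij]])
      then show "set_lebesgue_integral lebesgue (einterval a b) (\<lambda>x. complex_of_real x ^ n * ?f x) = 0"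
        by (simp add: comm)
    qed
    then show ?thesis by eventually_elim auto
  qed
  have "AE x in lebesgue. \<forall>ij\<in>{..<N} \<times> {..<N}. x \<in> einterval a b \<longrightarrow>
      (T * W x) $$ ij = (W x * mat_adjoint T) $$ ij"
    using entry by (intro AE_finite_allI) auto
  then show ?thesis
  proof eventually_elim
    case (elim x)
    show ?case
    proof
      assume x: "x \<in> einterval a b"
      show "T * W x = W x * mat_adjoint T"
        using elim x T weight_carrier[OF W x] by (intro eq_matI) (auto simp del: index_mult_mat(1))
    qed
  qed
qed

text \<open>A kernel vector of the moment of order 0 would give a nonzero constant polynomial
  orthogonal to itself, against definiteness.\<close>

lemma moment_0_inverse:
  assumes W: "matrix_weight a b N W"
  obtains S where "S \<in> carrier_mat N N" "moment a b N W 0 * S = 1\<^sub>m N" "S * moment a b N W 0 = 1\<^sub>m N"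
proof -
  let ?S0 = "moment a b N W 0"
  have "det ?S0 \<noteq> 0"
  proof
    assume "det ?S0 = 0"
    then obtain v where v: "v \<in> carrier_vec N" "v \<noteq> 0\<^sub>v N" "?S0 *\<^sub>v v = 0\<^sub>v N"
      using det_0_iff_vec_prod_zero[OF moment_carrier] by blast
    \<comment> \<open>Every column of \<open>B\<close> is \<open>v\<close>. Repeating the vector
      yields a square matrix, as the notion of a matrix polynomial demands.\<close>
    define B where "B = Matrix.mat N N (\<lambda>(i, j). v $ i)"
    have B: "B \<in> carrier_mat N N" by (simp add: B_def)
    have "?S0 * B = 0\<^sub>m N N"
    proof (rule eq_matI)
      fix i j assume "i < dim_row (0\<^sub>m N N :: complex mat)" "j < dim_col (0\<^sub>m N N :: complex mat)"
      then have ij: "i < N" "j < N" by auto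
      have "(?S0 * B) $$ (i, j) = (?S0 *\<^sub>v v) $ i"
        unfolding index_mult_mat_sum[OF moment_carrier B ij]
        using ij v(1) by (simp add: B_def scalar_prod_def lessThan_atLeast0)
      then show "(?S0 * B) $$ (i, j) = 0\<^sub>m N N $$ (i, j)" using v ij by simp
    qed (use B in auto)
    then have "mat_adjoint (?S0 * B) = mat_adjoint (0\<^sub>m N N)" by simp
    then have "mat_adjoint B * ?S0 = mat_adjoint (0\<^sub>m N N)"
      by (simp add: mat_adjoint_mult[OF moment_carrier B] mat_adjoint_moment[OF W])
    then have AS: "mat_adjoint B * ?S0 = 0\<^sub>m N N"
      by (auto intro!: eq_matI simp: conjugate_complex_def)
    have A: "mat_adjoint B \<in> carrier_mat N N" using B by simp
    have "mat_integral a b N (\<lambda>x. mat_poly_eval N 1 (\<lambda>_. mat_adjoint B) x * W x *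
        mat_adjoint (mat_poly_eval N 1 (\<lambda>_. mat_adjoint B) x)) = msum N 1 (\<lambda>k. msum N 1 (\<lambda>j. mat_adjoint B * moment a b N W (j + k)) * mat_adjoint (mat_adjoint B))"
      by (rule mat_integral_poly_sandwich[OF W]) (use A in auto)
    also have "\<dots> = 0\<^sub>m N N"
    proof (rule msum_zero)
      fix k :: nat assume "k < 1"
      then have "msum N 1 (\<lambda>j. mat_adjoint B * moment a b N W (j + k)) = 0\<^sub>m N N"
        by (intro msum_zero) (auto simp: AS)
      then show "msum N 1 (\<lambda>j. mat_adjoint B * moment a b N W (j + k)) * mat_adjoint (mat_adjoint B) = 0\<^sub>m N N"
        using B by simp
    qed
    finally have "mat_adjoint B = 0\<^sub>m N N"
      using weight_definite[OF W, where A = "\<lambda>_. mat_adjoint B" and d = 1 and j = 0] A by simp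
    then have "mat_adjoint B $$ (0, i) = 0" if "i < N" for i
      using that by simp
    then have "v $ i = 0" if "i < N" for i
      using that by (simp add: B_def conjugate_complex_def)
    then show False
      using v by (auto intro!: eq_vecI)
  qed
  then have "?S0 \<in> Units (ring_mat TYPE(complex) N ())"
    by (rule det_non_zero_imp_unit[OF moment_carrier])
  then show thesis
    using that unfolding Units_def ring_mat_def by auto
qed

section \<open>From the commutant to a selfadjoint matrix intertwining the moments\<close>

lemma add_eq_0_imp_eq_uminus:
  fixes A B :: "complex mat"
  assumes "A \<in> carrier_mat n m" "B \<in> carrier_mat n m" "A + B = 0\<^sub>m n m"
  shows "B = (- 1) \<cdot>\<^sub>m A"
proof (rule eq_matI)
  fix i j assume "i < dim_row ((- 1) \<cdot>\<^sub>m A)" "j < dim_col ((- 1) \<cdot>\<^sub>m A)"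
  then have ij: "i < n" "j < m" using assms by auto
  have "(A + B) $$ (i, j) = 0" using assms(3) ij by simp
  then show "B $$ (i, j) = ((- 1) \<cdot>\<^sub>m A) $$ (i, j)"
    using assms(1,2) ij by (simp add: add_eq_0_iff)
qed (use assms in auto)

text \<open>Orthogonality of \<open>P n\<close> to the constants, multiplied by the inverse
  \<open>S\<close>, expresses the normalized moment of order \<open>n\<close> through coefficients
  of \<open>P n\<close> and normalized moments of lower order. \<open>T\<close> commutes with the
  former by assumption and with the latter by induction.\<close>

lemma commutant_moment_quotient:
  assumes W: "matrix_weight a b N W" and P: "monic_orthogonal_polys a b N W P"
    and T: "T \<in> commutant N P"
    and S: "S \<in> carrier_mat N N" "moment a b N W 0 * S = 1\<^sub>m N"
  shows "T * (moment a b N W n * S) = (moment a b N W n * S) * T"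
proof (induction n rule: less_induct)
  case (less n)
  let ?X = "\<lambda>n. moment a b N W n * S" and ?c = "coeff_mat (P n)"
  have Tc: "T \<in> carrier_mat N N" using T by (simp add: commutant_def)
  have X: "?X j \<in> carrier_mat N N" for j using S by simp
  show ?case
  proof (cases "n = 0")
    case True
    then show ?thesis using S Tc by simp
  next
    case False
    note c = coeff_P_carrier[OF W P]
    let ?Y = "msum N n (\<lambda>j. ?c j * ?X j)"
    have cm: "?c j * moment a b N W j \<in> carrier_mat N N" for j
      by (rule mult_carrier_square[OF c moment_carrier])
    have cX: "?c j * ?X j \<in> carrier_mat N N" for j
      by (rule mult_carrier_square[OF c X])
    have "?Y + ?c n * ?X n = msum N (Suc n) (\<lambda>j. ?c j * ?X j)"
      by (rule msum_Suc[symmetric]) (rule cX)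
    also have "\<dots> = msum N (Suc n) (\<lambda>j. ?c j * moment a b N W j * S)"
      by (intro msum_cong) (simp add: assoc_mult_square[OF c moment_carrier S(1)])
    also have "\<dots> = msum N (Suc n) (\<lambda>j. ?c j * moment a b N W j) * S"
      by (rule msum_mult[OF S(1) cm, symmetric])
    \<comment> \<open>Orthogonality to the power \<open>k = 0\<close>, available because
      \<open>n\<close> is positive.\<close>
    also have "\<dots> = 0\<^sub>m N N"
      using moment_orthogonality[OF W P, of 0 n] False S by simp
    finally have "?Y + ?X n = 0\<^sub>m N N"
      using X by (simp add: coeff_P_lead[OF W P])
    then have Xn: "?X n = (- 1) \<cdot>\<^sub>m ?Y"
      by (rule add_eq_0_imp_eq_uminus[OF msum_carrier X])
    have "T * ?Y = msum N n (\<lambda>j. T * (?c j * ?X j))"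
      by (rule mult_msum[OF Tc cX])
    also have "\<dots> = msum N n (\<lambda>j. ?c j * ?X j * T)"
    proof (rule msum_cong)
      fix j assume j: "j < n"
      have "T * (?c j * ?X j) = T * ?c j * ?X j"
        by (rule assoc_mult_square[OF Tc c X, symmetric])
      also have "T * ?c j = ?c j * T"
        using T j commutant_iff_coeffs[OF W P Tc] by simp
      also have "?c j * T * ?X j = ?c j * (T * ?X j)"
        by (rule assoc_mult_square[OF c Tc X])
      also have "\<dots> = ?c j * ?X j * T"
        unfolding less.IH[OF j] by (rule assoc_mult_square[OF c X Tc, symmetric])
      finally show "T * (?c j * ?X j) = ?c j * ?X j * T" .
    qed
    also have "\<dots> = ?Y * T"
      by (rule msum_mult[OF Tc cX, symmetric])
    finally show ?thesis
      unfolding Xn mult_smult_distrib[OF Tc msum_carrier] mult_smult_assoc_mat[OF msum_carrier Tc] by simp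
  qed
qed

text \<open>With respect to the involution determined by the moment of order 0, \<open>T\<close>
  splits into a real and an imaginary part. Both intertwine the moments with their adjoints, and
  they cannot both be scalar.\<close>

lemma commutant_selfadjoint:
  assumes W: "matrix_weight a b N W" and P: "monic_orthogonal_polys a b N W P"
    and T: "T \<in> commutant N P" and nonscalar: "\<not> scalar_matrix N T"
  obtains H where "H \<in> carrier_mat N N" "\<not> scalar_matrix N H"
    "\<And>n. H * moment a b N W n = moment a b N W n * mat_adjoint H"
proof -
  let ?S = "moment a b N W"
  have Tc: "T \<in> carrier_mat N N" using T by (simp add: commutant_def)
  obtain R where R: "R \<in> carrier_mat N N" and S0R: "?S 0 * R = 1\<^sub>m N" and RS0: "R * ?S 0 = 1\<^sub>m N"
    by (rule moment_0_inverse[OF W])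
  have R_adj: "mat_adjoint R = R"
  proof -
    have "mat_adjoint R * ?S 0 = mat_adjoint (?S 0 * R)"
      by (simp add: mat_adjoint_mult[OF moment_carrier R] mat_adjoint_moment[OF W])
    then have "mat_adjoint R * ?S 0 = 1\<^sub>m N" by (simp add: S0R)
    moreover have "mat_adjoint R * ?S 0 * R = mat_adjoint R * (?S 0 * R)"
      using R by (intro assoc_mult_square) auto
    ultimately show ?thesis using R by (simp add: S0R)
  qed
  \<comment> \<open>The image of \<open>T\<close> under the involution.\<close>
  define D where "D = ?S 0 * mat_adjoint T * R"
  have Dc: "D \<in> carrier_mat N N" using Tc R by (simp add: D_def)
  have D_adj: "mat_adjoint D = R * (T * ?S 0)"
    unfolding D_def using Tc R
    by (simp add: mat_adjoint_mult[of _ N N _ N] mat_adjoint_moment[OF W] R_adj)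
  have TS: "T * ?S n = ?S n * mat_adjoint D" for n
  proof -
    \<comment> \<open>Inserting \<open>R * ?S 0\<close> exposes the normalized moment
      \<open>?S n * R\<close>, with which \<open>T\<close> commutes.\<close>
    have "T * ?S n = T * (?S n * R) * ?S 0"
      using Tc R by (simp add: assoc_mult_square[of _ N] RS0)
    also have "\<dots> = ?S n * R * T * ?S 0"
      by (simp add: commutant_moment_quotient[OF W P T R S0R])
    also have "\<dots> = ?S n * mat_adjoint D"
      unfolding D_adj using Tc R by (simp add: assoc_mult_square[of _ N])
    finally show ?thesis .
  qed
  have DS: "D * ?S n = ?S n * mat_adjoint T" for n
  proof -
    have "mat_adjoint (T * ?S n) = mat_adjoint (?S n * mat_adjoint D)" by (simp only: TS)
    then show ?thesis
      using Tc Dc by (simp add: mat_adjoint_mult[of _ N N _ N] mat_adjoint_moment[OF W])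
  qed
  \<comment> \<open>Up to real factors, \<open>c = 1\<close> and \<open>c = \<i>\<close> give the
    real and the imaginary part of \<open>T\<close>.\<close>
  define H where "H c = c \<cdot>\<^sub>m T + cnj c \<cdot>\<^sub>m D" for c
  have Hc: "H c \<in> carrier_mat N N" for c using Tc Dc by (simp add: H_def)
  have HS: "H c * ?S n = ?S n * mat_adjoint (H c)" for c n
  proof -
    have "H c * ?S n = c \<cdot>\<^sub>m (T * ?S n) + cnj c \<cdot>\<^sub>m (D * ?S n)"
      unfolding H_def using Tc Dc
      by (simp add: add_mult_distrib_mat[of _ N N _ _ N] mult_smult_assoc_mat[of _ N N _ N])
    also have "\<dots> = cnj c \<cdot>\<^sub>m (?S n * mat_adjoint T) + c \<cdot>\<^sub>m (?S n * mat_adjoint D)"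
      unfolding TS DS using Tc Dc by (intro comm_add_mat[of _ N N]) auto
    also have "\<dots> = ?S n * mat_adjoint (H c)"
      unfolding H_def using Tc Dc
      by (simp add: mat_adjoint_add[of _ N N] mat_adjoint_smult mult_add_distrib_mat[of _ N N _ N]
          mult_smult_distrib[of _ N N _ N])
    finally show ?thesis .
  qed
  have "\<not> scalar_matrix N (H 1) \<or> \<not> scalar_matrix N (H \<i>)"
  proof (rule ccontr)
    assume "\<not> ?thesis"
    then obtain c d where cd: "H 1 = c \<cdot>\<^sub>m 1\<^sub>m N" "H \<i> = d \<cdot>\<^sub>m 1\<^sub>m N"
      by (auto simp: scalar_matrix_def)
    \<comment> \<open>\<open>T\<close> is recovered as half of
      \<open>H 1 - \<i> \<cdot>\<^sub>m H \<i>\<close>, hence would be scalar too.\<close>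
    have "T = ((c - \<i> * d) / 2) \<cdot>\<^sub>m 1\<^sub>m N"
    proof (rule eq_matI)
      fix i j assume "i < dim_row (((c - \<i> * d) / 2) \<cdot>\<^sub>m 1\<^sub>m N)" "j < dim_col (((c - \<i> * d) / 2) \<cdot>\<^sub>m 1\<^sub>m N)"
      then have ij: "i < N" "j < N" by auto
      have "T $$ (i, j) + D $$ (i, j) = c * 1\<^sub>m N $$ (i, j)"
        using arg_cong[OF cd(1), of "\<lambda>A. A $$ (i, j)"] ij Tc Dc by (simp add: H_def)
      moreover have "\<i> * T $$ (i, j) - \<i> * D $$ (i, j) = d * 1\<^sub>m N $$ (i, j)"
        using arg_cong[OF cd(2), of "\<lambda>A. A $$ (i, j)"] ij Tc Dc by (simp add: H_def)
      then have "\<i> * (\<i> * T $$ (i, j) - \<i> * D $$ (i, j)) = \<i> * d * 1\<^sub>m N $$ (i, j)"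
        by simp
      then have "D $$ (i, j) - T $$ (i, j) = \<i> * d * 1\<^sub>m N $$ (i, j)"
        by (simp add: right_diff_distrib flip: mult.assoc)
      ultimately have "T $$ (i, j) * 2 = (c - \<i> * d) * 1\<^sub>m N $$ (i, j)"
        by (simp add: algebra_simps)
      then show "T $$ (i, j) = (((c - \<i> * d) / 2) \<cdot>\<^sub>m 1\<^sub>m N) $$ (i, j)"
        using ij by (auto split: if_splits)
    qed (use Tc in auto)
    then show False using nonscalar by (auto simp: scalar_matrix_def)
  qed
  then show thesis using that[OF Hc _ HS] by blast
qed

section \<open>Block diagonal weights\<close>

lemma inner_mult_adjoint:
  fixes E :: "complex mat"
  assumes E: "E \<in> carrier_mat m N" and w: "w \<in> carrier_vec N" and v: "v \<in> carrier_vec m"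
  shows "(E *\<^sub>v w) \<bullet>c v = w \<bullet>c (mat_adjoint E *\<^sub>v v)"
proof -
  have "(E *\<^sub>v w) $ i = (\<Sum>p<N. E $$ (i, p) * w $ p)" if "i < m" for i
    using E w that by (auto simp: scalar_prod_def lessThan_atLeast0)
  then have "(E *\<^sub>v w) \<bullet>c v = (\<Sum>i<m. (\<Sum>p<N. E $$ (i, p) * w $ p) * cnj (v $ i))"
    using E v by (simp add: scalar_prod_def lessThan_atLeast0 conjugate_complex_def del: index_mult_mat_vec)
  also have "\<dots> = (\<Sum>i<m. \<Sum>p<N. w $ p * (E $$ (i, p) * cnj (v $ i)))"
    by (simp add: sum_distrib_left sum_distrib_right mult_ac)
  also have "\<dots> = (\<Sum>p<N. w $ p * (\<Sum>i<m. E $$ (i, p) * cnj (v $ i)))"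
    by (subst sum.swap) (simp add: sum_distrib_left)
  also have "\<dots> = w \<bullet>c (mat_adjoint E *\<^sub>v v)"
  proof -
    have "(mat_adjoint E *\<^sub>v v) $ p = (\<Sum>i<m. cnj (E $$ (i, p)) * v $ i)" if "p < N" for p
      using E v that by (auto simp: scalar_prod_def lessThan_atLeast0 conjugate_complex_def)
    then show ?thesis
      using E w by (simp add: scalar_prod_def lessThan_atLeast0 conjugate_complex_def del: index_mult_mat_vec)
  qed
  finally show ?thesis .
qed

lemma congruence_quadratic:
  fixes E :: "complex mat"
  assumes E: "E \<in> carrier_mat m N" and W: "W \<in> carrier_mat N N" and v: "v \<in> carrier_vec m"
  shows "((E * W * mat_adjoint E) *\<^sub>v v) \<bullet>c v = (W *\<^sub>v (mat_adjoint E *\<^sub>v v)) \<bullet>c (mat_adjoint E *\<^sub>v v)"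
proof -
  have u: "mat_adjoint E *\<^sub>v v \<in> carrier_vec N"
    using mult_mat_vec_carrier[OF mat_adjoint_carrier[OF E] v] .
  have "(E * W * mat_adjoint E) *\<^sub>v v = E *\<^sub>v (W *\<^sub>v (mat_adjoint E *\<^sub>v v))"
    unfolding assoc_mult_mat_vec[OF mult_carrier_mat[OF E W] mat_adjoint_carrier[OF E] v]
    by (rule assoc_mult_mat_vec[OF E W u])
  then show ?thesis
    using inner_mult_adjoint[OF E mult_mat_vec_carrier[OF W u] v] by simp
qed

lemma congruence_adjoint:
  fixes E :: "complex mat"
  assumes E: "E \<in> carrier_mat m N" and W: "W \<in> carrier_mat N N" "mat_adjoint W = W"
  shows "mat_adjoint (E * W * mat_adjoint E) = E * W * mat_adjoint E"
  unfolding mat_adjoint_mult[OF mult_carrier_mat[OF E W(1)] mat_adjoint_carrier[OF E]]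
    mat_adjoint_mult[OF E W(1)] W(2) mat_adjoint_adjoint
  by (rule assoc_mult_mat[OF E W(1) mat_adjoint_carrier[OF E], symmetric])

lemma pos_semidef_congruence:
  assumes E: "E \<in> carrier_mat m N" and W: "pos_semidef N W"
  shows "pos_semidef m (E * W * mat_adjoint E)"
proof -
  have Wc: "W \<in> carrier_mat N N" "mat_adjoint W = W" using W by (simp_all add: pos_semidef_def)
  have "0 \<le> ((E * W * mat_adjoint E) *\<^sub>v v) \<bullet>c v" if v: "v \<in> carrier_vec m" for v
    unfolding congruence_quadratic[OF E Wc(1) v]
    using W mult_mat_vec_carrier[OF mat_adjoint_carrier[OF E] v] by (simp add: pos_semidef_def)
  then show ?thesis
    using congruence_adjoint[OF E Wc] mult_carrier_mat[OF mult_carrier_mat[OF E Wc(1)] mat_adjoint_carrier[OF E]]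
    by (simp add: pos_semidef_def)
qed

text \<open>The right inverse of \<open>E\<close> becomes a left inverse of
  \<open>mat_adjoint E\<close>, which is therefore injective and sends \<open>v\<close> to a nonzero
  vector.\<close>

lemma pos_def_congruence:
  assumes E: "E \<in> carrier_mat m N" and G: "G \<in> carrier_mat N m" and EG: "E * G = 1\<^sub>m m"
    and W: "pos_def N W"
  shows "pos_def m (E * W * mat_adjoint E)"
proof -
  have Wc: "W \<in> carrier_mat N N" "mat_adjoint W = W" using W by (simp_all add: pos_def_def)
  have "0 < ((E * W * mat_adjoint E) *\<^sub>v v) \<bullet>c v" if v: "v \<in> carrier_vec m" "v \<noteq> 0\<^sub>v m" for v
  proof -
    have u: "mat_adjoint E *\<^sub>v v \<in> carrier_vec N"
      using mult_mat_vec_carrier[OF mat_adjoint_carrier[OF E] v(1)] .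
    have "mat_adjoint E *\<^sub>v v \<noteq> 0\<^sub>v N"
    proof
      assume "mat_adjoint E *\<^sub>v v = 0\<^sub>v N"
      then have "mat_adjoint G *\<^sub>v (mat_adjoint E *\<^sub>v v) = 0\<^sub>v m"
        using mat_adjoint_carrier[OF G] by (intro eq_vecI) (auto simp: scalar_prod_def)
      moreover have "mat_adjoint G *\<^sub>v (mat_adjoint E *\<^sub>v v) = mat_adjoint (E * G) *\<^sub>v v"
        unfolding mat_adjoint_mult[OF E G]
        by (rule assoc_mult_mat_vec[OF mat_adjoint_carrier[OF G] mat_adjoint_carrier[OF E] v(1), symmetric])
      ultimately show False using v by (simp add: EG)
    qed
    then show ?thesis
      unfolding congruence_quadratic[OF E Wc(1) v(1)] using W u by (simp add: pos_def_def)
  qed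
  then show ?thesis
    using congruence_adjoint[OF E Wc] mult_carrier_mat[OF mult_carrier_mat[OF E Wc(1)] mat_adjoint_carrier[OF E]]
    by (simp add: pos_def_def)
qed

text \<open>Covers both a change of basis (\<open>m = N\<close>) and the compression to a block
  (\<open>m < N\<close>). The right inverse of \<open>E\<close> preserves definiteness.\<close>

lemma matrix_weight_congruence:
  assumes W: "matrix_weight a b N W" and m: "0 < m"
    and E: "E \<in> carrier_mat m N" and G: "G \<in> carrier_mat N m" and EG: "E * G = 1\<^sub>m m"
  shows "matrix_weight a b m (\<lambda>x. E * W x * mat_adjoint E)"
  unfolding matrix_weight_def
proof (intro conjI ballI allI)
  show "a < b" using W by (simp add: matrix_weight_def)
  show "pos_semidef m (E * W x * mat_adjoint E)" if "x \<in> einterval a b" for x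
    using W that by (intro pos_semidef_congruence[OF E]) (simp add: matrix_weight_def)
  have "AE x in lebesgue. x \<in> einterval a b \<longrightarrow> pos_def N (W x)"
    using W by (simp add: matrix_weight_def)
  then show "AE x in lebesgue. x \<in> einterval a b \<longrightarrow> pos_def m (E * W x * mat_adjoint E)"
    by eventually_elim (use pos_def_congruence[OF E G EG] in blast)
  fix n
  show "mat_integrable a b m (\<lambda>x. complex_of_real x ^ n \<cdot>\<^sub>m (E * W x * mat_adjoint E))"
    unfolding mat_integrable_def
  proof (intro allI impI)
    fix i j assume ij: "i < m" "j < m"
    have eq: "(complex_of_real x ^ n \<cdot>\<^sub>m (E * W x * mat_adjoint E)) $$ (i, j)
      = (\<Sum>q<N. \<Sum>p<N. (E $$ (i, p) * cnj (E $$ (j, q))) * (complex_of_real x ^ n * W x $$ (p, q)))"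
      if x: "x \<in> einterval a b" for x
    proof -
      have "(complex_of_real x ^ n \<cdot>\<^sub>m (E * W x * mat_adjoint E)) $$ (i, j)
        = complex_of_real x ^ n * (E * W x * mat_adjoint E) $$ (i, j)"
        using E ij by (intro index_smult_mat) auto
      then show ?thesis
        unfolding index_sandwich[OF E weight_carrier[OF W x] E ij]
        by (simp add: sum_distrib_left mult_ac)
    qed
    show "set_integrable lebesgue (einterval a b)
        (\<lambda>x. (complex_of_real x ^ n \<cdot>\<^sub>m (E * W x * mat_adjoint E)) $$ (i, j))"
      by (subst set_integrable_cong[OF refl refl eq])
        (auto intro!: set_integrable_sum set_integrable_mult_right weight_integrable[OF W])
  qed
qed (fact m)

text \<open>The quadratic form splits along the decomposition of the vector. A weight must be
  semidefinite at every point, while the direct sum built below is known to equal the congruent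
  weight only almost everywhere, so semidefiniteness is obtained from the blocks.\<close>

lemma pos_semidef_four_block:
  assumes A: "pos_semidef n A" and B: "pos_semidef m B"
  shows "pos_semidef (n + m) (four_block_mat A (0\<^sub>m n m) (0\<^sub>m m n) B)" (is "pos_semidef _ ?D")
proof -
  have c: "A \<in> carrier_mat n n" "B \<in> carrier_mat m m" "mat_adjoint A = A" "mat_adjoint B = B"
    using A B by (simp_all add: pos_semidef_def)
  have Dc: "?D \<in> carrier_mat (n + m) (n + m)" using c by simp
  have herm: "conjugate (A $$ (j, i)) = A $$ (i, j)" if "i < n" "j < n" for i j
    using index_mat_adjoint[of i A j] c that by simp
  have herm': "conjugate (B $$ (j, i)) = B $$ (i, j)" if "i < m" "j < m" for i j
    using index_mat_adjoint[of i B j] c that by simp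
  have "mat_adjoint ?D = ?D"
    by (rule eq_matI) (use c herm herm' in auto)
  moreover have "0 \<le> (?D *\<^sub>v v) \<bullet>c v" if v: "v \<in> carrier_vec (n + m)" for v
  proof -
    define v1 v2 where "v1 = vec_first v n" and "v2 = vec_last v m"
    have v12: "v1 \<in> carrier_vec n" "v2 \<in> carrier_vec m" "v = v1 @\<^sub>v v2"
      using v by (simp_all add: v1_def v2_def)
    have "?D *\<^sub>v v = (A *\<^sub>v v1 + 0\<^sub>m n m *\<^sub>v v2) @\<^sub>v (0\<^sub>m m n *\<^sub>v v1 + B *\<^sub>v v2)"
      unfolding v12(3) by (rule four_block_mat_mult_vec) (use c v12 in auto)
    also have "0\<^sub>m n m *\<^sub>v v2 = 0\<^sub>v n" using v12 by (intro eq_vecI) (auto simp: scalar_prod_def)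
    also have "0\<^sub>m m n *\<^sub>v v1 = 0\<^sub>v m" using v12 by (intro eq_vecI) (auto simp: scalar_prod_def)
    finally have Dv: "?D *\<^sub>v v = (A *\<^sub>v v1) @\<^sub>v (B *\<^sub>v v2)"
      using c v12 by simp
    have "conjugate v = conjugate v1 @\<^sub>v conjugate v2"
      unfolding v12(3) by (intro eq_vecI) auto
    then have "(?D *\<^sub>v v) \<bullet>c v = (A *\<^sub>v v1) \<bullet>c v1 + (B *\<^sub>v v2) \<bullet>c v2"
      unfolding Dv using c v12 by (simp add: scalar_prod_append[of _ n _ m])
    then show ?thesis
      using A B v12 by (simp add: pos_semidef_def)
  qed
  ultimately show ?thesis using Dc by (simp add: pos_semidef_def)
qed

text \<open>Cutting \<open>M\<close> into its first \<open>k\<close> rows and the remaining ones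
  gives two compressions of \<open>W\<close>. Each is a weight, and their direct sum agrees with the
  congruent weight wherever the off-diagonal blocks vanish.\<close>

lemma reduces_of_block_diagonal:
  assumes W: "matrix_weight a b N W" and M: "M \<in> carrier_mat N N" "invertible_mat M"
    and k: "0 < k" "k < N"
    and block: "AE x in lebesgue. x \<in> einterval a b \<longrightarrow> (\<forall>i<k. \<forall>j. k \<le> j \<and> j < N \<longrightarrow>
      (M * W x * mat_adjoint M) $$ (i, j) = 0 \<and> (M * W x * mat_adjoint M) $$ (j, i) = 0)"
  shows "reduces a b N W"
proof -
  obtain M' where M': "M' \<in> carrier_mat N N" and MM': "M * M' = 1\<^sub>m N"
    using M unfolding invertible_mat_def inverts_mat_def
    by (metis carrier_matD carrier_matI index_mult_mat(2,3) index_one_mat(2,3))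
  define l where "l = N - k"
  have l: "0 < l" "l < N" "N = k + l" using k by (simp_all add: l_def)
  \<comment> \<open>The matching columns of the inverse \<open>M'\<close> are right inverses of the
    row blocks of \<open>M\<close>.\<close>
  define E1 where "E1 = Matrix.mat k N (\<lambda>(i, j). M $$ (i, j))"
  define E2 where "E2 = Matrix.mat l N (\<lambda>(i, j). M $$ (i + k, j))"
  define G1 where "G1 = Matrix.mat N k (\<lambda>(i, j). M' $$ (i, j))"
  define G2 where "G2 = Matrix.mat N l (\<lambda>(i, j). M' $$ (i, j + k))"
  have E: "E1 \<in> carrier_mat k N" "E2 \<in> carrier_mat l N"
    and G: "G1 \<in> carrier_mat N k" "G2 \<in> carrier_mat N l"
    by (simp_all add: E1_def E2_def G1_def G2_def)
  have EG1: "E1 * G1 = 1\<^sub>m k"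
  proof (rule eq_matI)
    fix i j assume "i < dim_row (1\<^sub>m k :: complex mat)" "j < dim_col (1\<^sub>m k :: complex mat)"
    then have ij: "i < k" "j < k" "i < N" "j < N" using k by auto
    have "(E1 * G1) $$ (i, j) = (M * M') $$ (i, j)"
      unfolding index_mult_mat_sum[OF E(1) G(1) ij(1,2)] index_mult_mat_sum[OF M(1) M' ij(3,4)]
      using ij by (simp add: E1_def G1_def)
    then show "(E1 * G1) $$ (i, j) = 1\<^sub>m k $$ (i, j)" using ij by (simp add: MM')
  qed (use E G in auto)
  have EG2: "E2 * G2 = 1\<^sub>m l"
  proof (rule eq_matI)
    fix i j assume "i < dim_row (1\<^sub>m l :: complex mat)" "j < dim_col (1\<^sub>m l :: complex mat)"
    then have ij: "i < l" "j < l" "i + k < N" "j + k < N" using l by auto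
    have "(E2 * G2) $$ (i, j) = (M * M') $$ (i + k, j + k)"
      unfolding index_mult_mat_sum[OF E(2) G(2) ij(1,2)] index_mult_mat_sum[OF M(1) M' ij(3,4)]
      using ij by (simp add: E2_def G2_def)
    then show "(E2 * G2) $$ (i, j) = 1\<^sub>m l $$ (i, j)" using ij by (simp add: MM')
  qed (use E G in auto)
  define V1 where "V1 x = E1 * W x * mat_adjoint E1" for x
  define V2 where "V2 x = E2 * W x * mat_adjoint E2" for x
  have V1: "matrix_weight a b k V1" and V2: "matrix_weight a b l V2"
    unfolding V1_def[abs_def] V2_def[abs_def]
    using matrix_weight_congruence[OF W k(1) E(1) G(1) EG1] matrix_weight_congruence[OF W l(1) E(2) G(2) EG2] .
  let ?D = "direct_sum [V1, V2]"
  have D: "?D x = four_block_mat (V1 x) (0\<^sub>m k l) (0\<^sub>m l k) (V2 x)" for x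
    using E
    by (simp only: direct_sum_def list.map diag_block_mat.simps(2)[of "V1 x" "[V2 x]"]
        diag_block_mat_singleton Let_def) (simp add: V1_def V2_def)
  have V_entry: "V1 x $$ (i, j) = (M * W x * mat_adjoint M) $$ (i, j)" if "i < k" "j < k" "x \<in> einterval a b" for i j x
  proof -
    have "i < N" "j < N" using that k by auto
    then show ?thesis
      unfolding V1_def index_sandwich[OF E(1) weight_carrier[OF W that(3)] E(1) that(1,2)]
        index_sandwich[OF M(1) weight_carrier[OF W that(3)] M(1) \<open>i < N\<close> \<open>j < N\<close>]
      using that by (simp add: E1_def)
  qed
  have V_entry': "V2 x $$ (i, j) = (M * W x * mat_adjoint M) $$ (i + k, j + k)" if "i < l" "j < l" "x \<in> einterval a b" for i j x
  proof -
    have "i + k < N" "j + k < N" using that l by auto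
    then show ?thesis
      unfolding V2_def index_sandwich[OF E(2) weight_carrier[OF W that(3)] E(2) that(1,2)]
        index_sandwich[OF M(1) weight_carrier[OF W that(3)] M(1) \<open>i + k < N\<close> \<open>j + k < N\<close>]
      using that by (simp add: E2_def)
  qed
  have ae: "AE x in lebesgue. x \<in> einterval a b \<longrightarrow> ?D x = M * W x * mat_adjoint M"
    using block
  proof eventually_elim
    case (elim x)
    show ?case
    proof
      assume x: "x \<in> einterval a b"
      have dims: "dim_row (V1 x) = k" "dim_col (V1 x) = k" "dim_row (V2 x) = l" "dim_col (V2 x) = l"
        using E by (auto simp: V1_def V2_def)
      show "?D x = M * W x * mat_adjoint M"
      proof (rule eq_matI)
        fix i j assume "i < dim_row (M * W x * mat_adjoint M)" "j < dim_col (M * W x * mat_adjoint M)"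
        then have ij: "i < k + l" "j < k + l" using M l by auto
        have entry: "?D x $$ (i, j) = (if i < k then if j < k then V1 x $$ (i, j) else 0
          else if j < k then 0 else V2 x $$ (i - k, j - k))"
          unfolding D using ij dims by (subst index_mat_four_block(1)) auto
        \<comment> \<open>The condition says that exactly one of the two indices belongs to the
          first block.\<close>
        have "(M * W x * mat_adjoint M) $$ (i, j) = 0" if "i < k \<longleftrightarrow> \<not> j < k"
          using elim x that ij unfolding l(3)[symmetric] by (metis not_le)
        moreover have "V1 x $$ (i, j) = (M * W x * mat_adjoint M) $$ (i, j)" if "i < k" "j < k"
          using V_entry that x by blast
        moreover have "V2 x $$ (i - k, j - k) = (M * W x * mat_adjoint M) $$ (i, j)" if "\<not> i < k" "\<not> j < k"
          using V_entry'[of "i - k" "j - k" x] that x ij by simp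
        ultimately show "?D x $$ (i, j) = (M * W x * mat_adjoint M) $$ (i, j)"
          unfolding entry by auto
      qed (use M l dims D in auto)
    qed
  qed
  have "matrix_weight a b N (\<lambda>x. M * W x * mat_adjoint M)"
    using matrix_weight_congruence[OF W _ M(1) M' MM'] k by simp
  then have pd: "AE x in lebesgue. x \<in> einterval a b \<longrightarrow> pos_def N (M * W x * mat_adjoint M)"
    by (simp add: matrix_weight_def)
  have "matrix_weight a b N ?D"
    unfolding matrix_weight_def
  proof (intro conjI ballI allI)
    show "a < b" "0 < N" using W by (simp_all add: matrix_weight_def)
    show "pos_semidef N (?D x)" if "x \<in> einterval a b" for x
      unfolding D l(3) using V1 V2 that by (intro pos_semidef_four_block) (auto simp: matrix_weight_def)
    show "AE x in lebesgue. x \<in> einterval a b \<longrightarrow> pos_def N (?D x)"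
      using ae pd by eventually_elim auto
    fix n
    show "mat_integrable a b N (\<lambda>x. complex_of_real x ^ n \<cdot>\<^sub>m ?D x)"
      unfolding mat_integrable_def
    proof (intro allI impI)
      fix i j assume ij: "i < N" "j < N"
      have dims: "dim_row (V1 x) = k" "dim_col (V1 x) = k" "dim_row (V2 x) = l" "dim_col (V2 x) = l" for x
        using E by (auto simp: V1_def V2_def)
      have entry: "(complex_of_real x ^ n \<cdot>\<^sub>m ?D x) $$ (i, j) =
          (if i < k then if j < k then complex_of_real x ^ n * V1 x $$ (i, j) else 0
          else if j < k then 0 else complex_of_real x ^ n * V2 x $$ (i - k, j - k))" for x
        unfolding D using ij dims l by simp
      have "set_integrable lebesgue (einterval a b) (\<lambda>x. complex_of_real x ^ n * V1 x $$ (i, j))" if "i < k" "j < k"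
        by (rule weight_integrable[OF V1 that])
      moreover have "set_integrable lebesgue (einterval a b) (\<lambda>x. complex_of_real x ^ n * V2 x $$ (i - k, j - k))"
        if "\<not> i < k" "\<not> j < k"
        by (rule weight_integrable[OF V2]) (use ij l that in auto)
      moreover have "set_integrable lebesgue (einterval a b) (\<lambda>x. 0 :: complex)"
        by (simp add: set_integrable_def)
      ultimately show "set_integrable lebesgue (einterval a b) (\<lambda>x. (complex_of_real x ^ n \<cdot>\<^sub>m ?D x) $$ (i, j))"
        unfolding entry by (cases "i < k"; cases "j < k"; simp)
    qed
  qed
  then have "equivalent_weights a b N W ?D"
    unfolding equivalent_weights_def using W M ae by blast
  moreover have "\<forall>V \<in> set [V1, V2]. \<exists>n<N. matrix_weight a b n V"
    using V1 V2 k(2) l(2) by auto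
  ultimately show ?thesis
    unfolding reduces_def by blast
qed

text \<open>A selfadjoint \<open>H\<close> from the commutant intertwines the moments, hence the
  weight itself on a finite interval. Its eigenspaces then decouple the weight at almost every point
  simultaneously, since \<open>H\<close> is constant.\<close>

lemma reduces_of_commutant:
  assumes W: "matrix_weight a b N W" and P: "monic_orthogonal_polys a b N W P"
    and fin: "\<bar>a\<bar> \<noteq> \<infinity>" "\<bar>b\<bar> \<noteq> \<infinity>"
    and T: "T \<in> commutant N P" "\<not> scalar_matrix N T"
  shows "reduces a b N W"
proof -
  obtain H where H: "H \<in> carrier_mat N N" "\<not> scalar_matrix N H"
    and HS: "\<And>n. H * moment a b N W n = moment a b N W n * mat_adjoint H"
    using commutant_selfadjoint[OF W P T] by blast
  have HW: "AE x in lebesgue. x \<in> einterval a b \<longrightarrow> H * W x = W x * mat_adjoint H"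
    by (rule weight_commute_of_moments[OF W H(1) fin HS])
  have "AE x in lebesgue. x \<in> einterval a b \<longrightarrow> pos_def N (W x)" and ab: "a < b"
    using W by (simp_all add: matrix_weight_def)
  with HW have "AE x in lebesgue. x \<in> einterval a b \<longrightarrow> H * W x = W x * mat_adjoint H \<and> pos_def N (W x)"
    by auto
  \<comment> \<open>One point suffices for the diagonalization of the constant matrix
    \<open>H\<close>.\<close>
  from infinite_of_AE_einterval[OF ab this] obtain x0 where
    x0: "H * W x0 = W x0 * mat_adjoint H" "pos_def N (W x0)"
    using infinite_imp_nonempty by blast
  obtain M l k where M: "M \<in> carrier_mat N N" "invertible_mat M" and k: "0 < k" "k < N"
    and MH: "\<And>i j. i < N \<Longrightarrow> j < N \<Longrightarrow> (M * H) $$ (i, j) = l i * M $$ (i, j)"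
    and l_real: "\<And>i. i < N \<Longrightarrow> cnj (l i) = l i"
    and l_neq: "\<And>i j. i < k \<Longrightarrow> k \<le> j \<Longrightarrow> j < N \<Longrightarrow> l i \<noteq> l j"
    using diagonalize_selfadjoint[OF H(1) x0(2,1) H(2)] by metis
  \<comment> \<open>\<open>H\<close> is moved across \<open>W x\<close> and evaluated on the
    eigenrows of \<open>M\<close> on either side; the eigenvalue on the right appears without
    conjugate because it is real. Entries between different eigenvalues must vanish.\<close>
  have intertwine: "l i * (M * W x * mat_adjoint M) $$ (i, j) = l j * (M * W x * mat_adjoint M) $$ (i, j)"
    if x: "x \<in> einterval a b" and comm: "H * W x = W x * mat_adjoint H" and ij: "i < N" "j < N" for x i j
  proof -
    note Wx = weight_carrier[OF W x]
    have MHc: "M * H \<in> carrier_mat N N" using M H by simp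
    have "M * H * W x * mat_adjoint M = M * (H * W x) * mat_adjoint M"
      using M H Wx by (simp add: assoc_mult_square[of _ N])
    also have "\<dots> = M * W x * mat_adjoint (M * H)"
      unfolding comm mat_adjoint_mult[OF M(1) H(1)] using M H Wx by (simp add: assoc_mult_square[of _ N])
    finally have "(M * H * W x * mat_adjoint M) $$ (i, j) = (M * W x * mat_adjoint (M * H)) $$ (i, j)"
      by simp
    then show ?thesis
      unfolding index_sandwich[OF MHc Wx M(1) ij] index_sandwich[OF M(1) Wx MHc ij] index_sandwich[OF M(1) Wx M(1) ij]
      using ij by (simp add: MH l_real sum_distrib_left mult_ac del: index_mult_mat(1))
  qed
  show ?thesis
  proof (rule reduces_of_block_diagonal[OF W M k])
    show "AE x in lebesgue. x \<in> einterval a b \<longrightarrow> (\<forall>i<k. \<forall>j. k \<le> j \<and> j < N \<longrightarrow>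
      (M * W x * mat_adjoint M) $$ (i, j) = 0 \<and> (M * W x * mat_adjoint M) $$ (j, i) = 0)"
      using HW
    proof eventually_elim
      case (elim x)
      show ?case
      proof (intro impI allI)
        fix i j assume "x \<in> einterval a b" "i < k" "k \<le> j \<and> j < N"
        then show "(M * W x * mat_adjoint M) $$ (i, j) = 0 \<and> (M * W x * mat_adjoint M) $$ (j, i) = 0"
          using elim intertwine[of x i j] intertwine[of x j i] l_neq[of i j] k
          by (simp del: index_mult_mat(1))
      qed
    qed
  qed
qed

text \<open>The projection \<open>E\<close> onto the first block commutes with the direct sum.
  Transported back through \<open>M\<close>, it intertwines \<open>W\<close> almost everywhere and
  hence the moments; it is not scalar because the block is neither empty nor everything.\<close>

lemma commutant_of_reduces:
  assumes W: "matrix_weight a b N W" and P: "monic_orthogonal_polys a b N W P"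
    and red: "reduces a b N W"
  shows "\<exists>T \<in> commutant N P. \<not> scalar_matrix N T"
proof -
  obtain Vs where Vs: "\<forall>V \<in> set Vs. \<exists>n<N. matrix_weight a b n V"
    and eq: "equivalent_weights a b N W (direct_sum Vs)"
    using red by (auto simp: reduces_def)
  have D: "matrix_weight a b N (direct_sum Vs)" and ab: "a < b" and N: "0 < N"
    using eq by (simp_all add: equivalent_weights_def matrix_weight_def)
  obtain M where M: "M \<in> carrier_mat N N" "invertible_mat M"
    and ae: "AE x in lebesgue. x \<in> einterval a b \<longrightarrow> direct_sum Vs x = M * W x * mat_adjoint M"
    using eq by (auto simp: equivalent_weights_def)
  obtain R where R: "R \<in> carrier_mat N N" and MR: "M * R = 1\<^sub>m N"
    using M unfolding invertible_mat_def inverts_mat_def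
    by (metis carrier_matD carrier_matI index_mult_mat(2,3) index_one_mat(2,3))
  have RM: "R * M = 1\<^sub>m N" by (rule mat_mult_left_right_inverse[OF M(1) R MR])
  obtain x0 where "x0 \<in> einterval a b" using einterval_nonempty[OF ab] by blast
  then have "direct_sum Vs x0 \<in> carrier_mat N N" by (rule weight_carrier[OF D])
  \<comment> \<open>An empty direct sum would have size 0, whereas \<open>N\<close> is
    positive.\<close>
  then have "Vs \<noteq> []" using N by (auto simp: direct_sum_def)
  then obtain V Vs' where Vs_eq: "Vs = V # Vs'" by (cases Vs) auto
  then obtain n where n: "n < N" and V: "matrix_weight a b n V" using Vs by auto
  have n0: "0 < n" using V by (simp add: matrix_weight_def)
  define E where "E = Matrix.mat N N (\<lambda>(i, j). if i = j \<and> i < n then 1 else 0 :: complex)"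
  have E: "E \<in> carrier_mat N N" by (simp add: E_def)
  have E_adj: "mat_adjoint E = E"
    by (rule eq_matI) (auto simp: E_def conjugate_complex_def)
  have comm: "E * direct_sum Vs x = direct_sum Vs x * E" if x: "x \<in> einterval a b" for x
  proof (rule eq_matI)
    let ?B = "direct_sum Vs x"
    have B: "?B \<in> carrier_mat N N" by (rule weight_carrier[OF D x])
    fix i j assume "i < dim_row (?B * E)" "j < dim_col (?B * E)"
    then have ij: "i < N" "j < N" using B E by auto
    have Vx: "V x \<in> carrier_mat n n" by (rule weight_carrier[OF V x])
    have off: "?B $$ (i, j) = 0" if "i < n \<longleftrightarrow> \<not> j < n"
    proof -
      let ?C = "diag_block_mat (map (\<lambda>V. V x) Vs')"
      have B_eq: "?B = four_block_mat (V x) (0\<^sub>m n (dim_col ?C)) (0\<^sub>m (dim_row ?C) n) ?C"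
        using Vx by (simp add: direct_sum_def Vs_eq Let_def)
      then have "n + dim_row ?C = N" "n + dim_col ?C = N"
        using B Vx by (metis carrier_matD index_mat_four_block(2,3))+
      then show ?thesis
        unfolding B_eq using Vx ij that by (subst index_mat_four_block(1)) auto
    qed
    \<comment> \<open>Left multiplication by \<open>E\<close> keeps the rows of the first block,
      right multiplication its columns. The results can differ only in the off-diagonal blocks,
      which are zero.\<close>
    have "(E * ?B) $$ (i, j) = (\<Sum>p<N. if p = i then (if i < n then ?B $$ (i, j) else 0) else 0)"
      unfolding index_mult_mat_sum[OF E B ij] using ij by (intro sum.cong) (auto simp: E_def)
    moreover have "(?B * E) $$ (i, j) = (\<Sum>p<N. if p = j then (if j < n then ?B $$ (i, j) else 0) else 0)"
      unfolding index_mult_mat_sum[OF B E ij] using ij by (intro sum.cong) (auto simp: E_def)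
    ultimately show "(E * ?B) $$ (i, j) = (?B * E) $$ (i, j)"
      using off ij by auto
  qed (use weight_carrier[OF D x] E in auto)
  define T where "T = R * E * M"
  have T: "T \<in> carrier_mat N N" using R E M by (simp add: T_def)
  have MT: "M * T = E * M"
  proof -
    have "M * T = M * R * (E * M)"
      unfolding T_def using R E M by (simp add: assoc_mult_square[of _ N])
    then show ?thesis using E M by (simp add: MR)
  qed
  have MadjR: "mat_adjoint M * mat_adjoint R = 1\<^sub>m N"
    using mat_adjoint_mult[OF R M(1)] by (simp add: RM)
  have "AE x in lebesgue. x \<in> einterval a b \<longrightarrow> T * W x = W x * mat_adjoint T"
    using ae
  proof eventually_elim
    case (elim x)
    show ?case
    proof
      assume x: "x \<in> einterval a b"
      note Wx = weight_carrier[OF W x]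
      let ?M' = "mat_adjoint M" and ?R' = "mat_adjoint R"
      have c: "?M' \<in> carrier_mat N N" "?R' \<in> carrier_mat N N" using M R by simp_all
      \<comment> \<open>Multiplying by \<open>R\<close> on the left and by its adjoint on the right
        undoes the change of basis on both sides.\<close>
      have "E * (M * W x * ?M') = (M * W x * ?M') * E"
        using comm[OF x] elim x by simp
      then have "R * (E * (M * W x * ?M')) * ?R' = R * ((M * W x * ?M') * E) * ?R'" by simp
      moreover have "R * (E * (M * W x * ?M')) * ?R' = T * W x * (?M' * ?R')"
        unfolding T_def using R E M Wx c by (simp add: assoc_mult_square[of _ N])
      moreover have "R * ((M * W x * ?M') * E) * ?R' = (R * M) * W x * (?M' * E * ?R')"
        using R E M Wx c by (simp add: assoc_mult_square[of _ N])
      moreover have "?M' * E * ?R' = mat_adjoint T"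
        unfolding T_def using R E M c
        by (simp add: mat_adjoint_mult[of _ N N _ N] E_adj assoc_mult_square[of _ N])
      ultimately show "T * W x = W x * mat_adjoint T"
        using T Wx by (simp add: MadjR RM)
    qed
  qed
  then have "T \<in> commutant N P"
    using moment_commute_of_weight[OF W T] by (intro commutant_of_moments[OF W P T]) blast
  moreover have "\<not> scalar_matrix N T"
  proof
    assume "scalar_matrix N T"
    then obtain c where c: "T = c \<cdot>\<^sub>m 1\<^sub>m N" by (auto simp: scalar_matrix_def)
    have "E = E * M * R" using E M R by (simp add: assoc_mult_square[of _ N] MR)
    also have "\<dots> = M * T * R" by (simp add: MT)
    also have "\<dots> = c \<cdot>\<^sub>m 1\<^sub>m N"
      unfolding c using M R by (simp add: mult_smult_distrib[of _ N N _ N] mult_smult_assoc_mat[of _ N N _ N] MR)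
    finally have Ec: "E = c \<cdot>\<^sub>m 1\<^sub>m N" .
    \<comment> \<open>Index 0 lies inside the first block, and \<open>n\<close> is the first index
      outside it.\<close>
    have "c = 1" using arg_cong[OF Ec, of "\<lambda>A. A $$ (0, 0)"] n0 N by (simp add: E_def)
    moreover have "c = 0" using arg_cong[OF Ec, of "\<lambda>A. A $$ (n, n)"] n by (simp add: E_def)
    ultimately show False by simp
  qed
  ultimately show ?thesis by blast
qed

theorem corollary4p4:
  fixes a b :: ereal and N :: nat
    and W :: "real \<Rightarrow> complex mat" and P :: "nat \<Rightarrow> complex poly mat"
  assumes "matrix_weight a b N W"
    and "monic_orthogonal_polys a b N W P"
  shows "(reduces a b N W \<longrightarrow> (\<exists>T \<in> commutant N P. \<not> scalar_matrix N T)) \<and>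
    (\<bar>a\<bar> \<noteq> \<infinity> \<and> \<bar>b\<bar> \<noteq> \<infinity> \<longrightarrow>
      (\<exists>T \<in> commutant N P. \<not> scalar_matrix N T) \<longrightarrow> reduces a b N W)"
proof (intro conjI impI)
  show "\<exists>T \<in> commutant N P. \<not> scalar_matrix N T" if "reduces a b N W"
    using commutant_of_reduces[OF assms that] .
  show "reduces a b N W"
    if "\<bar>a\<bar> \<noteq> \<infinity> \<and> \<bar>b\<bar> \<noteq> \<infinity>" "\<exists>T \<in> commutant N P. \<not> scalar_matrix N T"
    using that reduces_of_commutant[OF assms] by auto
qed

end
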